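(* $\displaystyle\lim_{n\to\infty}\sqrt[n]{W_4(n)}\le21.97225.$
   Context: The stack-sorting map $s$ is defined recursively on permutations (in one-line notation) of distinct positive integers by $s(\emptyset)=\emptyset$ and, if the largest entry of $\pi$ is $n$ and $\pi=LnR$, $s(\pi)=s(L)s(R)n$. A permutation $\pi$ of $[n]$ is $4$-stack sortable if $s^4(\pi)=12\cdots n$, and $W_4(n)$ is the number of $4$-stack sortable permutations of $[n]$. It is known that $\lim_{n\to\infty}\sqrt[n]{W_4(n)}$ exists. *)

theory Defs
  imports Complex_Main
begin

lemma takeWhile_neq_shorter:
  "m \<in> set xs \<Longrightarrow> length (takeWhile (\<lambda>x. x \<noteq> m) xs) < length xs"
  by (induction xs) auto

function stack_sort :: "nat list \<Rightarrow> nat list" where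
  "stack_sort xs =
     (if xs = [] then []
      else (let m = Max (set xs); L = takeWhile (\<lambda>x. x \<noteq> m) xs;
                R = tl (dropWhile (\<lambda>x. x \<noteq> m) xs)
            in stack_sort L @ stack_sort R @ [m]))"
  by pat_completeness auto
termination
proof (relation "measure length")
  show "wf (measure length)" by simp
next
  fix xs :: "nat list" and m L
  assume "xs \<noteq> []" "m = Max (set xs)" "L = takeWhile (\<lambda>x. x \<noteq> m) xs"
  then have "m \<in> set xs" by simp
  then have "length (takeWhile (\<lambda>x. x \<noteq> m) xs) < length xs"
    by (rule takeWhile_neq_shorter)
  then show "(L, xs) \<in> measure length" using \<open>L = _\<close> by simp
next
  fix xs :: "nat list" and m L R
  assume "xs \<noteq> []" "m = Max (set xs)"
    "R = tl (dropWhile (\<lambda>x. x \<noteq> m) xs)"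
  then show "(R, xs) \<in> measure length"
    using length_dropWhile_le[of "\<lambda>x. x \<noteq> m" xs] by (cases xs) auto
qed

declare stack_sort.simps[simp del]

definition perms_of :: "nat \<Rightarrow> nat list set" where
  "perms_of n = {xs. distinct xs \<and> set xs = {1..n}}"

definition four_stack_sortable :: "nat list \<Rightarrow> bool" where
  "four_stack_sortable xs \<longleftrightarrow> (stack_sort ^^ 4) xs = [1..<length xs + 1]"

definition W4 :: "nat \<Rightarrow> nat" where
  "W4 n = card {xs \<in> perms_of n. four_stack_sortable xs}"

end

theory Submission
  imports Defs "HOL-Computational_Algebra.Formal_Power_Series"
begin

text \<open>
  Weight each permutation by \<open>y\<close> to the number of its descents. Splitting a permutation at its last
  descent shows that the total weight of the preimages of a permutation of length \<open>n\<close> with \<open>k\<close> descents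
  is at most the sum of products of \<open>k + 1\<close> Narayana polynomials over the compositions of
  \<open>n - k\<close>, hence at most \<open>T x\<^sup>-\<^sup>n (x y T)\<^sup>k\<close> whenever \<open>T \<ge> x (1 + T) (1 + y T)\<close>. Two such steps reduce
  4-stack-sortable permutations to 2-stack-sortable ones, with a smaller descent weight \<open>y\<close>.
  The latter satisfy a quadratic equation with one catalytic variable, the number of sum components of
  the sorted permutation. For fixed \<open>x\<close> and \<open>y\<close> an explicit nonnegative solution of this equation
  bounds their generating function; it comes from the Brown--Tutte parametrization
  \<open>x = u (1 - v)\<^sup>2\<close>, \<open>x y = v (1 - u)\<^sup>2\<close>.
\<close>

section \<open>Descents and preimages under stack-sorting\<close>

fun des :: "nat list \<Rightarrow> nat" where
  "des [] = 0"
| "des [a] = 0"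
| "des (a # b # xs) = (if b < a then 1 else 0) + des (b # xs)"

lemma des_append:
  assumes "P \<noteq> []" "I \<noteq> []"
  shows "des (P @ I) = des P + (if hd I < last P then 1 else 0) + des I"
  using assms
proof (induction P rule: des.induct)
  case (2 a)
  then show ?case by (cases I) auto
qed auto

lemma des_eq_0_iff: "des xs = 0 \<longleftrightarrow> sorted xs"
  by (induction xs rule: des.induct) (auto simp: not_less intro: order_trans)

text \<open>The cut is at the last descent, so \<open>I\<close> is the longest sorted
  suffix.\<close>

lemma des_pos_split:
  assumes "des xs > 0"
  obtains P I where "xs = P @ I" "P \<noteq> []" "I \<noteq> []" "hd I < last P" "sorted I"
proof -
  have "\<exists>P I. xs = P @ I \<and> P \<noteq> [] \<and> I \<noteq> [] \<and> hd I < last P \<and> sorted I"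
    using assms
  proof (induction xs rule: des.induct)
    case (3 a b xs)
    show ?case
    proof (cases "des (b # xs) > 0")
      case True
      then obtain P I where "b # xs = P @ I" "P \<noteq> []" "I \<noteq> []" "hd I < last P" "sorted I"
        using "3.IH" by blast
      then have "a # b # xs = (a # P) @ I \<and> a # P \<noteq> [] \<and> I \<noteq> [] \<and> hd I < last (a # P) \<and> sorted I"
        by simp
      then show ?thesis by blast
    next
      case False
      then have "sorted (b # xs)" "b < a"
        using 3(2) des_eq_0_iff[of "b # xs"] by (auto split: if_splits)
      then have "a # b # xs = [a] @ (b # xs) \<and> [a] \<noteq> [] \<and> b # xs \<noteq> []
          \<and> hd (b # xs) < last [a] \<and> sorted (b # xs)"
        by simp
      then show ?thesis by blast
    qed
  qed auto
  then show ?thesis using that by blast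
qed

text \<open>Together with \<open>distinct_max_split\<close> this replaces \<open>takeWhile\<close>
  and \<open>dropWhile\<close> by an explicit factorization at the maximum.\<close>

lemma stack_sort_append_max:
  assumes "\<And>a. a \<in> set L \<Longrightarrow> a < m" "\<And>a. a \<in> set R \<Longrightarrow> a < m"
  shows "stack_sort (L @ m # R) = stack_sort L @ stack_sort R @ [m]"
proof -
  have M: "Max (set (L @ m # R)) = m"
    using assms by (intro Max_eqI) (auto intro: less_imp_le)
  have "takeWhile (\<lambda>x. x \<noteq> m) (L @ m # R) = L" "dropWhile (\<lambda>x. x \<noteq> m) (L @ m # R) = m # R"
    using assms(1) by (auto simp: takeWhile_append dropWhile_append)
  then show ?thesis
    using M by (subst stack_sort.simps) (simp add: Let_def)
qed

lemma distinct_max_split: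
  fixes xs :: "nat list"
  assumes "distinct xs" "xs \<noteq> []"
  obtains L m R where "xs = L @ m # R" "\<And>a. a \<in> set L \<Longrightarrow> a < m" "\<And>a. a \<in> set R \<Longrightarrow> a < m"
proof -
  have "Max (set xs) \<in> set xs" using assms(2) by simp
  then obtain L R where LR: "xs = L @ Max (set xs) # R" by (meson split_list)
  have "a < Max (set xs)" if "a \<in> set L \<union> set R" for a
  proof -
    have "a \<noteq> Max (set xs)" using that LR assms(1) by (metis Un_iff distinct.simps(2) distinct_append
      disjoint_iff list.set_intros(1))
    moreover have "a \<in> set xs" using that by (subst LR) auto
    then have "a \<le> Max (set xs)" by simp
    ultimately show ?thesis by simp
  qed
  then show ?thesis using that LR by blast
qed

lemma stack_sort_distinct_set_length:
  "distinct xs \<Longrightarrow> distinct (stack_sort xs) \<and> set (stack_sort xs) = set xs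
     \<and> length (stack_sort xs) = length xs"
proof (induction "length xs" arbitrary: xs rule: less_induct)
  case less
  show ?case
  proof (cases "xs = []")
    case True
    then show ?thesis by (simp add: stack_sort.simps)
  next
    case False
    then obtain L m R where LR: "xs = L @ m # R" "\<And>a. a \<in> set L \<Longrightarrow> a < m" "\<And>a. a \<in> set R \<Longrightarrow> a < m"
      using distinct_max_split less.prems by metis
    have "distinct L" "distinct R" "length L < length xs" "length R < length xs"
      using less.prems LR(1) by auto
    then have "distinct (stack_sort L) \<and> set (stack_sort L) = set L \<and> length (stack_sort L) = length L"
        "distinct (stack_sort R) \<and> set (stack_sort R) = set R \<and> length (stack_sort R) = length R"
      using less.hyps by blast+
    moreover have "stack_sort xs = stack_sort L @ stack_sort R @ [m]"
      unfolding LR(1) using LR(2,3) by (rule stack_sort_append_max)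
    ultimately show ?thesis using less.prems LR(1) by auto
  qed
qed

lemma stack_sort_Nil [simp]: "stack_sort [] = []"
  by (simp add: stack_sort.simps)

section \<open>Weighted preimages\<close>

text \<open>The total weight \<open>y ^ des\<close> of the preimages of a list of distinct numbers: a preimage
  \<open>L @ m # R\<close> corresponds to a split of \<open>butlast xs\<close> into \<open>stack_sort L\<close> and \<open>stack_sort R\<close>.\<close>

function fert :: "real \<Rightarrow> nat list \<Rightarrow> real" where
  "fert y xs =
     (if xs = [] then 1
      else if \<exists>a\<in>set xs. last xs < a then 0
      else let w = butlast xs in
        \<Sum>i\<le>length xs - 1. (if i < length xs - 1 then y else 1) * fert y (take i w) * fert y (drop i w))"
  by pat_completeness auto
termination
  by (relation "measure (\<lambda>(y, xs). length xs)") (auto simp flip: length_greater_0_conv)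

declare fert.simps [simp del]

lemma fert_Nil [simp]: "fert y [] = 1"
  by (simp add: fert.simps)

lemma fert_snoc:
  "fert y (w @ [m]) =
     (if \<forall>a\<in>set w. a \<le> m
      then \<Sum>i\<le>length w. (if i < length w then y else 1) * fert y (take i w) * fert y (drop i w)
      else 0)"
  by (subst fert.simps) (auto simp: Let_def not_le)

lemma fert_nonneg: "0 \<le> y \<Longrightarrow> 0 \<le> fert y xs"
proof (induction "length xs" arbitrary: xs rule: less_induct)
  case less
  show ?case
  proof (cases xs rule: rev_cases)
    case (snoc w m)
    have "0 \<le> fert y (take i w)" "0 \<le> fert y (drop i w)" for i
      using less snoc by auto
    then show ?thesis unfolding snoc fert_snoc using less.prems
      by (auto intro!: sum_nonneg mult_nonneg_nonneg)
  qed simp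
qed

text \<open>For a preimage \<open>L @ m # R\<close> of \<open>w @ [m]\<close>, the images of
  \<open>L\<close> and \<open>R\<close> are complementary blocks of \<open>w\<close>. Its descents
  are those of \<open>L\<close>, those of \<open>R\<close>, and one after \<open>m\<close> unless
  \<open>R\<close> is empty, which is the factor in \<open>fert_snoc\<close>.\<close>

lemma descent_sum_preimages_le_fert:
  assumes "0 \<le> y"
  shows "finite {\<sigma>. distinct \<sigma> \<and> stack_sort \<sigma> = \<pi>} \<and>
     (\<Sum>\<sigma> | distinct \<sigma> \<and> stack_sort \<sigma> = \<pi>. y ^ des \<sigma>) \<le> fert y \<pi>"
proof (induction "length \<pi>" arbitrary: \<pi> rule: less_induct)
  case less
  define Pre where "Pre p = {\<sigma>. distinct \<sigma> \<and> stack_sort \<sigma> = p}" for p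
  have Nil_iff: "\<sigma> = []" if "distinct \<sigma>" "stack_sort \<sigma> = []" for \<sigma>
    using stack_sort_distinct_set_length[OF that(1)] that(2) by auto
  show ?case
  proof (cases \<pi> rule: rev_cases)
    case Nil
    have "{\<sigma>. distinct \<sigma> \<and> stack_sort \<sigma> = \<pi>} = {[]}"
      using Nil Nil_iff by auto
    then show ?thesis using Nil by simp
  next
    case (snoc w m)
    have split: "\<exists>i\<le>length w. \<exists>L\<in>Pre (take i w). \<exists>R\<in>Pre (drop i w). \<sigma> = L @ m # R \<and> (\<forall>a\<in>set L \<union> set R. a < m)
      \<and> set w = set L \<union> set R"
      if \<sigma>: "\<sigma> \<in> Pre \<pi>" for \<sigma>
    proof -
      have d: "distinct \<sigma>" "stack_sort \<sigma> = w @ [m]" using \<sigma> snoc by (auto simp: Pre_def)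
      then have "\<sigma> \<noteq> []" by auto
      then obtain L m' R where LR: "\<sigma> = L @ m' # R"
          "\<And>a. a \<in> set L \<Longrightarrow> a < m'" "\<And>a. a \<in> set R \<Longrightarrow> a < m'"
        using distinct_max_split d by metis
      have "stack_sort \<sigma> = stack_sort L @ stack_sort R @ [m']"
        unfolding LR(1) using LR(2,3) by (rule stack_sort_append_max)
      then have w: "w = stack_sort L @ stack_sort R" "m' = m" using d by auto
      have dd: "distinct L" "distinct R" using d LR by auto
      have "L \<in> Pre (take (length (stack_sort L)) w)" "R \<in> Pre (drop (length (stack_sort L)) w)"
        using dd w by (auto simp: Pre_def)
      moreover have "set w = set L \<union> set R" using w stack_sort_distinct_set_length dd by auto
      moreover have "length (stack_sort L) \<le> length w" using w by simp
      moreover have "\<sigma> = L @ m # R" "\<forall>a\<in>set L \<union> set R. a < m"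
        using LR w(2) by auto
      ultimately show ?thesis
        by (intro exI[of _ "length (stack_sort L)"] conjI bexI[of _ L] bexI[of _ R])
    qed
    have Pi: "finite (Pre (take i w)) \<and> (\<Sum>\<sigma>\<in>Pre (take i w). y ^ des \<sigma>) \<le> fert y (take i w)"
             "finite (Pre (drop i w)) \<and> (\<Sum>\<sigma>\<in>Pre (drop i w). y ^ des \<sigma>) \<le> fert y (drop i w)" for i
      unfolding Pre_def by (rule less; simp add: snoc)+
    show ?thesis
    proof (cases "\<forall>a\<in>set w. a \<le> m")
      case False
      then have "Pre \<pi> = {}" using split by (metis equals0I less_imp_le)
      then show ?thesis using fert_nonneg[OF assms, of \<pi>] by (simp flip: Pre_def)
    next
      case True
      \<comment> \<open>\<open>Q\<close> holds the candidate triples, \<open>J\<close> reassembles a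
        triple, and \<open>wt\<close> is its weight.\<close>
      define Q where "Q = (SIGMA i:{..length w}. Pre (take i w) \<times> Pre (drop i w))"
      define J where "J = (\<lambda>(i::nat, L, R). L @ m # R)"
      define wt where "wt = (\<lambda>(i, L, R). (if i < length w then y else 1) * y ^ des L * y ^ des R)"
      have finQ: "finite Q" unfolding Q_def using Pi by auto
      have g: "\<exists>q\<in>Q. \<sigma> = J q \<and> y ^ des \<sigma> = wt q" if \<sigma>: "\<sigma> \<in> Pre \<pi>" for \<sigma>
      proof -
        obtain i L R where H: "i \<le> length w" "L \<in> Pre (take i w)" "R \<in> Pre (drop i w)"
          "\<sigma> = L @ m # R" "\<forall>a\<in>set L \<union> set R. a < m" using split[OF \<sigma>] by metis
        have lR: "length R = length w - i" using H(3) stack_sort_distinct_set_length[of R] by (auto simp: Pre_def)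
        have "des (m # R) = des R + (if i < length w then 1 else 0)"
          using H(5) lR H(1) by (cases R) auto
        moreover have "des (L @ m # R) = des L + des (m # R)"
        proof (cases "L = []")
          case False
          then have "last L < m" using H(5) by simp
          then show ?thesis using False by (simp add: des_append)
        qed simp
        ultimately have "y ^ des \<sigma> = wt (i, L, R)" by (auto simp: wt_def H(4) power_add)
        moreover have "(i, L, R) \<in> Q" using H by (auto simp: Q_def)
        ultimately show ?thesis using H(4) by (intro bexI[of _ "(i, L, R)"]) (auto simp: J_def)
      qed
      then have sub: "Pre \<pi> \<subseteq> J ` Q" by blast
      then have fin: "finite (Pre \<pi>)" using finQ finite_surj by blast
      \<comment> \<open>A triple is chosen for each preimage; \<open>J\<close> is a left inverse of
        the choice, which is therefore injective.\<close>
      obtain q where q: "\<And>\<sigma>. \<sigma> \<in> Pre \<pi> \<Longrightarrow> q \<sigma> \<in> Q \<and> \<sigma> = J (q \<sigma>) \<and> y ^ des \<sigma> = wt (q \<sigma>)"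
        using g by metis
      have inj: "inj_on q (Pre \<pi>)" using q by (metis inj_onI)
      have "(\<Sum>\<sigma>\<in>Pre \<pi>. y ^ des \<sigma>) = (\<Sum>\<sigma>\<in>Pre \<pi>. wt (q \<sigma>))" using q by simp
      also have "\<dots> = sum wt (q ` Pre \<pi>)" using inj by (simp add: sum.reindex)
      also have "\<dots> \<le> sum wt Q"
        using q finQ assms by (intro sum_mono2) (auto simp: wt_def)
      also have "\<dots> = (\<Sum>i\<le>length w. \<Sum>p\<in>Pre (take i w) \<times> Pre (drop i w). wt (i, p))"
        unfolding Q_def using Pi by (subst sum.Sigma) auto
      also have "\<dots> = (\<Sum>i\<le>length w. (if i < length w then y else 1) *
          (\<Sum>\<sigma>\<in>Pre (take i w). y ^ des \<sigma>) * (\<Sum>\<sigma>\<in>Pre (drop i w). y ^ des \<sigma>))"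
        by (simp add: wt_def sum.cartesian_product[symmetric] sum_product mult.assoc)
          (simp add: sum_distrib_left)
      also have "\<dots> \<le> fert y \<pi>"
        unfolding snoc fert_snoc using True Pi assms
        by (auto intro!: sum_mono mult_mono sum_nonneg mult_nonneg_nonneg fert_nonneg)
      finally show ?thesis using fin by (simp add: Pre_def)
    qed
  qed
qed

section \<open>Recursion along the last descent\<close>

text \<open>The summand \<open>q\<close> corresponds to the hook of a valid hook configuration that starts at the last
  descent top and shelters the next \<open>q\<close> entries.\<close>

lemma fert_last_descent:
  assumes "0 \<le> y" "P \<noteq> []" "I \<noteq> []" "hd I < last P"
  shows "fert y (P @ I) \<le> y * (\<Sum>q=1..<length I. fert y (P @ drop (Suc q) I) * fert y (take q I))"
  using assms(2-)
proof (induction "length P + length I" arbitrary: P I rule: less_induct)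
  case less
  have nn: "0 \<le> fert y xs" for xs using fert_nonneg[OF assms(1)] .
  have rhs0: "0 \<le> y * (\<Sum>q=1..<length I. fert y (P @ drop (Suc q) I) * fert y (take q I))"
    using assms(1) nn by (auto intro!: mult_nonneg_nonneg sum_nonneg)
  obtain I' n where I: "I = I' @ [n]" using less.prems(2) by (metis rev_exhaust)
  show ?case
  proof (cases "\<forall>a\<in>set (P @ I'). a \<le> n")
    case False
    have "fert y (P @ I) = 0" using fert_snoc[of y "P @ I'" n] False by (auto simp: I)
    then show ?thesis using rhs0 by simp
  next
    case True
    have "I' \<noteq> []"
    proof
      assume "I' = []"
      then have "n < last P" using I less.prems(3) by simp
      moreover have "last P \<le> n" using True less.prems(1) by simp
      ultimately show False by simp
    qed
    then have hd: "hd I' < last P" using less.prems(3) I by simp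
    define p r where "p = length P" and "r = length I'"
    have r: "0 < r" using \<open>I' \<noteq> []\<close> r_def by simp
    \<comment> \<open>The factor of \<open>fert_snoc\<close>: \<open>y\<close> unless the right
      block is empty.\<close>
    define wt where "wt j k = (if j < k then y else (1::real))" for j k :: nat
    have wt: "0 \<le> wt j k" for j k using assms(1) by (simp add: wt_def)
    define U where "U J q = fert y (P @ drop (Suc q) J)" for J q
    have splitsum: "(\<Sum>i\<le>p + k. g i) = (\<Sum>i<p. g i) + (\<Sum>j\<le>k. g (p + j))" for g :: "nat \<Rightarrow> real" and k
    proof -
      have "{..p + k} = {..<p} \<union> {p..p + k}" by auto
      then have "sum g {..p + k} = sum g {..<p} + sum g {p..p + k}"
        by (simp add: sum.union_disjoint ivl_disj_int)
      moreover have "sum g {p..p + k} = (\<Sum>j\<le>k. g (p + j))"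
        using sum.shift_bounds_cl_nat_ivl[of g 0 p k] by (simp add: atMost_atLeast0 add.commute)
      ultimately show ?thesis by simp
    qed
    \<comment> \<open>Removing the maximum \<open>n\<close>, the cuts are separated into those
      before the end of \<open>P\<close> and the rest; \<open>j = 0\<close> is the cut exactly at
      the end of \<open>P\<close>.\<close>
    have FPJ: "fert y (P @ J @ [n]) = (\<Sum>i<p. y * fert y (take i P) * fert y (drop i P @ J)) +
       (\<Sum>j\<le>length J. wt j (length J) * fert y (P @ take j J) * fert y (drop j J))"
      if "\<forall>a\<in>set J. a \<le> n" for J
    proof -
      have "\<forall>a\<in>set (P @ J). a \<le> n" using True that by auto
      then have "fert y (P @ J @ [n]) = (\<Sum>i\<le>p + length J. wt i (p + length J) *
          fert y (take i (P @ J)) * fert y (drop i (P @ J)))"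
        using fert_snoc[of y "P @ J" n] by (simp add: wt_def p_def)
      also have "\<dots> = (\<Sum>i<p. y * fert y (take i P) * fert y (drop i P @ J)) +
       (\<Sum>j\<le>length J. wt j (length J) * fert y (P @ take j J) * fert y (drop j J))"
        unfolding splitsum by (intro arg_cong2[where f="(+)"] sum.cong) (auto simp: p_def wt_def)
      finally show ?thesis .
    qed
    \<comment> \<open>\<open>X\<close> collects the cuts before the end of \<open>P\<close>,
      \<open>Y\<close> those after it. In both, the last descent survives inside one block, so the
      induction hypothesis applies. Only the cut at the end of \<open>P\<close> destroys it.\<close>
    define X where "X = (\<Sum>i<p. y * fert y (take i P) * fert y (drop i P @ I'))"
    define Y where "Y = (\<Sum>j=1..r. wt j r * fert y (P @ take j I') * fert y (drop j I'))"
    have "(\<Sum>j\<le>r. wt j r * fert y (P @ take j I') * fert y (drop j I')) = y * fert y P * fert y I' + Y"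
    proof -
      have "{..r} = insert 0 {1..r}" by auto
      then show ?thesis using r by (simp add: Y_def wt_def)
    qed
    then have lhs: "fert y (P @ I) = X + y * fert y P * fert y I' + Y"
      unfolding I using FPJ[of I'] True by (simp add: X_def r_def)
    have X: "X \<le> (\<Sum>i<p. y * fert y (take i P) * (y * (\<Sum>q=1..<r. fert y (drop i P @ drop (Suc q) I') * fert y (take q I'))))"
      unfolding X_def
    proof (intro sum_mono mult_left_mono)
      fix i assume i: "i \<in> {..<p}"
      show "fert y (drop i P @ I') \<le> y * (\<Sum>q=1..<r. fert y (drop i P @ drop (Suc q) I') * fert y (take q I'))"
        unfolding r_def using i \<open>I' \<noteq> []\<close> hd by (intro less.hyps) (auto simp: p_def I)
    qed (use nn assms in auto)
    have "Y \<le> (\<Sum>j=1..r. wt j r * (y * (\<Sum>q=1..<j. fert y (P @ drop (Suc q) (take j I')) * fert y (take q I'))) * fert y (drop j I'))"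
      unfolding Y_def
    proof (intro sum_mono mult_right_mono mult_left_mono)
      fix j assume j: "j \<in> {1..r}"
      have "fert y (P @ take j I') \<le> y * (\<Sum>q=1..<length (take j I'). fert y (P @ drop (Suc q) (take j I')) * fert y (take q (take j I')))"
        using j hd \<open>I' \<noteq> []\<close> less.prems(1) by (intro less.hyps) (auto simp: I r_def)
      also have "length (take j I') = j" using j by (simp add: r_def)
      also have "(\<Sum>q=1..<j. fert y (P @ drop (Suc q) (take j I')) * fert y (take q (take j I'))) =
        (\<Sum>q=1..<j. fert y (P @ drop (Suc q) (take j I')) * fert y (take q I'))"
        by (intro sum.cong) auto
      finally show "fert y (P @ take j I') \<le> y * (\<Sum>q=1..<j. fert y (P @ drop (Suc q) (take j I')) * fert y (take q I'))" .
    qed (use nn wt in auto)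
    also have "\<dots> = (\<Sum>j=1..r. \<Sum>q=1..<j. y * (wt j r * fert y (P @ drop (Suc q) (take j I')) * fert y (drop j I') * fert y (take q I')))"
      by (simp add: sum_distrib_left sum_distrib_right mult_ac)
    \<comment> \<open>Exchange of summation: with the hook \<open>q\<close> fixed, the cut
      \<open>j\<close> ranges over the positions beyond the end of the hook.\<close>
    also have "\<dots> = (\<Sum>q=1..<r. \<Sum>j=Suc q..r. y * (wt j r * fert y (P @ drop (Suc q) (take j I')) * fert y (drop j I') * fert y (take q I')))"
      unfolding sum.Sigma[OF finite_atLeastAtMost ballI[OF finite_atLeastLessThan]]
        sum.Sigma[OF finite_atLeastLessThan ballI[OF finite_atLeastAtMost]]
      by (rule sum.reindex_bij_witness[of _ "\<lambda>(q, j). (j, q)" "\<lambda>(j, q). (q, j)"]) auto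
    finally have Y: "Y \<le> (\<Sum>q=1..<r. \<Sum>j=Suc q..r. y * (wt j r * fert y (P @ drop (Suc q) (take j I')) * fert y (drop j I') * fert y (take q I')))" .
    have U: "fert y (P @ drop (Suc q) I) = (\<Sum>i<p. y * fert y (take i P) * fert y (drop i P @ drop (Suc q) I')) +
       (\<Sum>j=Suc q..r. wt j r * fert y (P @ drop (Suc q) (take j I')) * fert y (drop j I'))" if q: "q < r" for q
    proof -
      define J where "J = drop (Suc q) I'"
      have JI: "drop (Suc q) I = J @ [n]" using q by (simp add: I J_def r_def)
      have J: "\<forall>a\<in>set J. a \<le> n" using True by (auto simp: J_def dest: in_set_dropD)
      have lJ: "length J = r - Suc q" by (simp add: J_def r_def)
      have "(\<Sum>j\<le>length J. wt j (length J) * fert y (P @ take j J) * fert y (drop j J)) =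
        (\<Sum>j=Suc q..r. wt j r * fert y (P @ drop (Suc q) (take j I')) * fert y (drop j I'))"
        using q by (intro sum.reindex_bij_witness[of _ "\<lambda>j. j - Suc q" "\<lambda>j. j + Suc q"])
          (auto simp: J_def r_def wt_def drop_take add.commute)
      then show ?thesis unfolding JI using FPJ[OF J] by (simp add: J_def)
    qed
    \<comment> \<open>The hook ending at \<open>n\<close>, with index \<open>q = r\<close>, is split
      off; it matches the cut at the end of \<open>P\<close>.\<close>
    have "y * (\<Sum>q=1..<length I. fert y (P @ drop (Suc q) I) * fert y (take q I)) =
       y * (\<Sum>q=1..<r. fert y (P @ drop (Suc q) I) * fert y (take q I')) + y * fert y P * fert y I'"
    proof -
      have "{1..<length I} = insert r {1..<r}" using r by (auto simp: I r_def Suc_le_eq)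
      then have "(\<Sum>q=1..<length I. fert y (P @ drop (Suc q) I) * fert y (take q I)) =
        fert y (P @ drop (Suc r) I) * fert y (take r I) + (\<Sum>q=1..<r. fert y (P @ drop (Suc q) I) * fert y (take q I))"
        by simp
      moreover have "drop (Suc r) I = []" "take r I = I'" by (auto simp: I r_def)
      moreover have "(\<Sum>q=1..<r. fert y (P @ drop (Suc q) I) * fert y (take q I)) =
         (\<Sum>q=1..<r. fert y (P @ drop (Suc q) I) * fert y (take q I'))"
        by (intro sum.cong) (auto simp: I r_def)
      ultimately show ?thesis by (simp add: algebra_simps)
    qed
    also have "y * (\<Sum>q=1..<r. fert y (P @ drop (Suc q) I) * fert y (take q I')) =
       (\<Sum>q=1..<r. y * ((\<Sum>i<p. y * fert y (take i P) * fert y (drop i P @ drop (Suc q) I')) +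
       (\<Sum>j=Suc q..r. wt j r * fert y (P @ drop (Suc q) (take j I')) * fert y (drop j I'))) * fert y (take q I'))"
      unfolding sum_distrib_left by (intro sum.cong) (auto simp: U)
    also have "\<dots> = (\<Sum>q=1..<r. \<Sum>i<p. y * (y * fert y (take i P) * fert y (drop i P @ drop (Suc q) I')) * fert y (take q I'))
      + (\<Sum>q=1..<r. \<Sum>j=Suc q..r. y * (wt j r * fert y (P @ drop (Suc q) (take j I')) * fert y (drop j I') * fert y (take q I')))"
      by (simp add: sum.distrib[symmetric] sum_distrib_left sum_distrib_right algebra_simps)
    also have "(\<Sum>q=1..<r. \<Sum>i<p. y * (y * fert y (take i P) * fert y (drop i P @ drop (Suc q) I')) * fert y (take q I'))
      = (\<Sum>i<p. y * fert y (take i P) * (y * (\<Sum>q=1..<r. fert y (drop i P @ drop (Suc q) I') * fert y (take q I'))))"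
      by (subst sum.swap) (simp add: sum_distrib_left mult_ac)
    finally show ?thesis using lhs X Y by linarith
  qed
qed

section \<open>Narayana polynomials and the bound for \<open>fert\<close>\<close>

lemma fert_map:
  "strict_mono_on (set xs) h \<Longrightarrow> fert y (map h xs) = fert y xs"
proof (induction "length xs" arbitrary: xs rule: less_induct)
  case less
  show ?case
  proof (cases xs rule: rev_cases)
    case (snoc w m)
    have m: "h a \<le> h m \<longleftrightarrow> a \<le> m" if "a \<in> set w" for a
      using strict_mono_on_less_eq[OF less.prems] that snoc by simp
    have mono: "strict_mono_on (set (take i w)) h" "strict_mono_on (set (drop i w)) h" for i
      using less.prems snoc by (auto simp: strict_mono_on_def dest!: in_set_takeD in_set_dropD)
    have "fert y (map h (take i w)) = fert y (take i w)" "fert y (map h (drop i w)) = fert y (drop i w)" for i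
      using less.hyps[OF _ mono(1), of i] less.hyps[OF _ mono(2), of i] snoc by simp_all
    then show ?thesis using m unfolding snoc
      by (simp add: fert_snoc take_map drop_map)
  qed simp
qed

lemma fert_increasing:
  assumes "sorted xs" "distinct xs"
  shows "fert y xs = fert y [0..<length xs]"
proof -
  have "strict_mono_on (set [0..<length xs]) (nth xs)"
    using assms strict_sorted_iff[of xs] by (auto simp: strict_mono_on_def sorted_wrt_nth_less)
  then show ?thesis using fert_map[of "[0..<length xs]" "nth xs" y] by (simp add: map_nth)
qed

text \<open>The values on increasing lists are the Narayana polynomials in \<open>y\<close>.
  Prefixes and suffixes of increasing lists are increasing, so the recursion is a
  convolution.\<close>

lemma fert_upt_Suc:
  "fert y [0..<Suc n] = (\<Sum>i\<le>n. fert y [0..<i] * ((if n - i = 0 then 1 else y) * fert y [0..<n - i]))"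
proof -
  have "fert y (drop i [0..<n]) = fert y [0..<n - i]" for i
    using fert_increasing[of "drop i [0..<n]" y] by (simp add: sorted_wrt_drop)
  moreover have "fert y (take i [0..<n]) = fert y [0..<i]" if "i \<le> n" for i
    using that by (simp add: take_upt)
  ultimately show ?thesis
    by (auto simp: fert_snoc intro!: sum.cong)
qed

text \<open>The triangle of index pairs lies in a square. Partial sums can thus be bounded
  inductively, without convergence arguments.\<close>

lemma sum_triangle_le_mult:
  fixes f g :: "nat \<Rightarrow> real"
  assumes "\<And>i. 0 \<le> f i" "\<And>i. 0 \<le> g i"
  shows "(\<Sum>n\<le>N. \<Sum>i\<le>n. f i * g (n - i)) \<le> (\<Sum>i\<le>N. f i) * (\<Sum>i\<le>N. g i)"
proof -
  have "(\<Sum>n\<le>N. \<Sum>i\<le>n. f i * g (n - i)) = (\<Sum>(i, j)\<in>{(i, j). i + j \<le> N}. f i * g j)"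
    by (rule sum.triangle_reindex_eq[symmetric])
  also have "\<dots> \<le> (\<Sum>(i, j)\<in>{..N} \<times> {..N}. f i * g j)"
    using assms by (intro sum_mono2) auto
  finally show ?thesis by (simp add: sum_product sum.cartesian_product)
qed

text \<open>The choice of \<open>x\<close> makes \<open>T\<close> a solution of
  \<open>T = x * (1 + T) * (1 + y * T)\<close>, the functional equation of the Narayana generating
  function. Its right-hand side, evaluated at a partial sum, bounds the next partial sum.\<close>

lemma fert_increasing_sum_le:
  assumes "0 \<le> y" "0 < T"
  defines "x \<equiv> T / ((1 + T) * (1 + y * T))"
  shows "(\<Sum>q=1..N. fert y [0..<q] * x ^ q) \<le> T"
proof (induction N)
  case 0
  then show ?case using assms by simp
next
  case (Suc N)
  have nn: "0 \<le> fert y xs" for xs using fert_nonneg[OF assms(1)] .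
  have x: "0 < x" using assms by (simp add: x_def add_pos_nonneg)
  define f g where "f i = fert y [0..<i] * x ^ i" and "g i = (if i = 0 then 1 else y) * (fert y [0..<i] * x ^ i)" for i
  have f0: "(\<Sum>i\<le>N. f i) = 1 + (\<Sum>q=1..N. fert y [0..<q] * x ^ q)"
    by (simp add: f_def atMost_atLeast0 sum.atLeast_Suc_atMost)
  have g0: "(\<Sum>i\<le>N. g i) = 1 + y * (\<Sum>q=1..N. fert y [0..<q] * x ^ q)"
    by (simp add: g_def atMost_atLeast0 sum.atLeast_Suc_atMost sum_distrib_left)
  have pos: "0 \<le> f i" "0 \<le> g i" for i using nn x assms by (auto simp: f_def g_def)
  have "(\<Sum>q=1..Suc N. fert y [0..<q] * x ^ q) = (\<Sum>n\<le>N. fert y [0..<Suc n] * x ^ Suc n)"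
    unfolding One_nat_def sum.shift_bounds_cl_Suc_ivl atMost_atLeast0 ..
  also have "\<dots> = x * (\<Sum>n\<le>N. \<Sum>i\<le>n. f i * g (n - i))"
    unfolding fert_upt_Suc sum_distrib_left sum_distrib_right
  proof (intro sum.cong refl)
    fix n i :: nat assume "i \<in> {..n}"
    then have "x ^ Suc n = x * (x ^ i * x ^ (n - i))" by (simp flip: power_add)
    then show "fert y [0..<i] * ((if n - i = 0 then 1 else y) * fert y [0..<n - i]) * x ^ Suc n = x * (f i * g (n - i))"
      by (simp add: f_def g_def)
  qed
  also have "\<dots> \<le> x * ((\<Sum>i\<le>N. f i) * (\<Sum>i\<le>N. g i))"
    using x pos by (intro mult_left_mono sum_triangle_le_mult) auto
  also have "\<dots> \<le> x * ((1 + T) * (1 + y * T))"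
    unfolding f0 g0 using Suc x nn assms
    by (intro mult_left_mono mult_mono add_mono) (auto intro!: sum_nonneg mult_nonneg_nonneg add_nonneg_nonneg)
  also have "\<dots> = T"
  proof -
    have "0 < (1 + T) * (1 + y * T)" using assms by (simp add: add_pos_nonneg)
    then have "(1 + T) * (1 + y * T) \<noteq> 0" by (rule less_imp_neq[symmetric])
    then show ?thesis by (simp only: x_def times_divide_eq_left nonzero_mult_div_cancel_right not_False_eq_True)
  qed
  finally show ?case .
qed

text \<open>Here \<open>D / T\<close> is \<open>1 / x\<close> for the \<open>x\<close> of
  \<open>fert_increasing_sum_le\<close>. Each use of \<open>fert_last_descent\<close> removes
  \<open>q + 1\<close> entries; summing over \<open>q\<close> gives the factor
  \<open>y * x * T\<close>, which is the base of the last power.\<close>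

lemma fert_le:
  assumes "0 \<le> y" "0 < T" "distinct \<pi>" "\<pi> \<noteq> []"
  defines "D \<equiv> (1 + T) * (1 + y * T)"
  shows "fert y \<pi> \<le> T * (D / T) ^ length \<pi> * (y * T\<^sup>2 / D) ^ des \<pi>"
  using assms(3,4)
proof (induction "length \<pi>" arbitrary: \<pi> rule: less_induct)
  case less
  have nn: "0 \<le> fert y xs" for xs using fert_nonneg[OF assms(1)] .
  have D: "0 < D" using assms by (simp add: D_def add_pos_nonneg)
  define x w where "x = T / D" and "w = y * T\<^sup>2 / D"
  have x: "0 < x" "D / T = inverse x" using D assms by (simp_all add: x_def)
  have "y * T\<^sup>2 \<le> D" using assms by (simp add: D_def algebra_simps power2_eq_square)
  then have w: "0 \<le> w" "w \<le> 1" "y * x * T = w"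
    using D assms by (auto simp: w_def x_def power2_eq_square)
  have S: "(\<Sum>q=1..N. fert y [0..<q] * x ^ q) \<le> T" for N
    using fert_increasing_sum_le[OF assms(1,2)] by (simp add: x_def D_def)
  have "fert y \<pi> \<le> T * inverse x ^ length \<pi> * w ^ des \<pi>"
  proof (cases "des \<pi> = 0")
    case True
    then have "fert y \<pi> = fert y [0..<length \<pi>]" using fert_increasing less.prems des_eq_0_iff by blast
    moreover have "fert y [0..<length \<pi>] * x ^ length \<pi> \<le> (\<Sum>q=1..length \<pi>. fert y [0..<q] * x ^ q)"
      using less.prems nn x by (intro member_le_sum) (auto simp: Suc_le_eq)
    ultimately have "fert y \<pi> * x ^ length \<pi> \<le> T" using S[of "length \<pi>"] by simp
    then show ?thesis using True x by (simp add: field_simps)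
  next
    case False
    then obtain P I where PI: "\<pi> = P @ I" "P \<noteq> []" "I \<noteq> []" "hd I < last P" "sorted I"
      using des_pos_split by blast
    have dI: "distinct I" "distinct P" using less.prems PI by auto
    have des: "des \<pi> = Suc (des P)" using PI des_eq_0_iff by (simp add: des_append)
    define n where "n = length \<pi>"
    have "fert y \<pi> \<le> y * (\<Sum>q=1..<length I. fert y (P @ drop (Suc q) I) * fert y (take q I))"
      unfolding PI(1) using PI assms(1) by (intro fert_last_descent)
    also have "\<dots> \<le> y * (\<Sum>q=1..<length I. (T * inverse x ^ (n - Suc q) * w ^ des P) * fert y [0..<q])"
    proof (intro mult_left_mono sum_mono mult_mono)
      fix q assume q: "q \<in> {1..<length I}"
      define U where "U = P @ drop (Suc q) I"
      have "distinct (take q I)" "sorted (take q I)" using dI PI by (auto simp: sorted_wrt_take)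
      then show "fert y (take q I) \<le> fert y [0..<q]"
        using fert_increasing[of "take q I" y] q by simp
      have lU: "length U = n - Suc q" using q by (auto simp: U_def n_def PI)
      have "distinct U" using less.prems PI by (auto simp: U_def dest: in_set_dropD)
      then have "fert y U \<le> T * inverse x ^ length U * w ^ des U"
        unfolding x(2)[symmetric] w_def
        using PI q by (intro less.hyps) (auto simp: U_def)
      \<comment> \<open>A descent may remain where \<open>P\<close> meets the rest of
        \<open>I\<close>; since \<open>w \<le> 1\<close>, it only lowers the bound.\<close>
      also have "\<dots> \<le> T * inverse x ^ length U * w ^ des P"
      proof (intro mult_left_mono power_decreasing)
        show "des P \<le> des U" using PI(2) by (cases "drop (Suc q) I = []") (auto simp: U_def des_append)
      qed (use w x assms in auto)
      finally show "fert y (P @ drop (Suc q) I) \<le> T * inverse x ^ (n - Suc q) * w ^ des P"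
        by (simp add: lU U_def[symmetric])
    qed (use nn x w assms in auto)
    also have "\<dots> = y * (T * inverse x ^ n * w ^ des P * x * (\<Sum>q=1..<length I. fert y [0..<q] * x ^ q))"
    proof -
      have "inverse x ^ (n - Suc q) = inverse x ^ n * x * x ^ q" if "q \<in> {1..<length I}" for q
      proof -
        have "inverse x ^ n = inverse x ^ (n - Suc q) * inverse x ^ Suc q"
          using that by (subst power_add[symmetric]) (simp add: n_def PI)
        then show ?thesis using x by (simp add: field_simps)
      qed
      then show ?thesis unfolding sum_distrib_left by (intro sum.cong) auto
    qed
    also have "\<dots> \<le> y * (T * inverse x ^ n * w ^ des P * x * T)"
    proof (intro mult_left_mono)
      have "(\<Sum>q=1..<length I. fert y [0..<q] * x ^ q) \<le> (\<Sum>q=1..length I. fert y [0..<q] * x ^ q)"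
        using nn x by (intro sum_mono2) auto
      then show "(\<Sum>q=1..<length I. fert y [0..<q] * x ^ q) \<le> T" using S[of "length I"] by linarith
    qed (use x w assms in auto)
    also have "\<dots> = T * inverse x ^ n * w ^ des P * (y * x * T)" by simp
    also have "\<dots> = T * inverse x ^ n * w ^ des \<pi>" unfolding w(3) des by simp
    finally show ?thesis by (simp add: n_def)
  qed
  then show ?case by (simp add: x(2) w_def)
qed

section \<open>One sorting step for weighted counts\<close>

definition sortable :: "nat \<Rightarrow> nat \<Rightarrow> nat list set" where
  "sortable t n = {\<sigma> \<in> perms_of n. (stack_sort ^^ t) \<sigma> = [1..<n + 1]}"

lemma finite_perms_of: "finite (perms_of n)"
proof (rule finite_subset)
  show "perms_of n \<subseteq> {xs. set xs \<subseteq> {1..n} \<and> length xs = n}"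
    using distinct_card by (fastforce simp: perms_of_def)
qed (simp add: finite_lists_length_eq)

lemma finite_sortable: "finite (sortable t n)"
  using finite_perms_of by (simp add: sortable_def)

lemma length_perms_of: "\<sigma> \<in> perms_of n \<Longrightarrow> length \<sigma> = n"
  using distinct_card by (fastforce simp: perms_of_def)

text \<open>Grouping by the image under \<open>stack_sort\<close> reduces this to
  \<open>descent_sum_preimages_le_fert\<close>.\<close>

lemma descent_sum_sortable_Suc_le_fert:
  fixes y :: real
  assumes "0 \<le> y"
  shows "(\<Sum>\<sigma>\<in>sortable (Suc t) n. y ^ des \<sigma>) \<le> (\<Sum>\<pi>\<in>sortable t n. fert y \<pi>)"
proof -
  have "stack_sort \<sigma> \<in> sortable t n" if "\<sigma> \<in> sortable (Suc t) n" for \<sigma>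
    using that stack_sort_distinct_set_length[of \<sigma>]
    by (auto simp: sortable_def perms_of_def funpow_Suc_right simp del: funpow.simps)
  then have "(\<Sum>\<sigma>\<in>sortable (Suc t) n. y ^ des \<sigma>) =
      (\<Sum>\<pi>\<in>sortable t n. \<Sum>\<sigma> | \<sigma> \<in> sortable (Suc t) n \<and> stack_sort \<sigma> = \<pi>. y ^ des \<sigma>)"
    by (intro sum.group[symmetric] finite_sortable) auto
  also have "\<dots> \<le> (\<Sum>\<pi>\<in>sortable t n. fert y \<pi>)"
  proof (intro sum_mono)
    fix \<pi>
    have "(\<Sum>\<sigma> | \<sigma> \<in> sortable (Suc t) n \<and> stack_sort \<sigma> = \<pi>. y ^ des \<sigma>) \<le>
        (\<Sum>\<sigma> | distinct \<sigma> \<and> stack_sort \<sigma> = \<pi>. y ^ des \<sigma>)"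
      using descent_sum_preimages_le_fert[OF assms, of \<pi>] assms
      by (intro sum_mono2) (auto simp: sortable_def perms_of_def)
    then show "(\<Sum>\<sigma> | \<sigma> \<in> sortable (Suc t) n \<and> stack_sort \<sigma> = \<pi>. y ^ des \<sigma>) \<le> fert y \<pi>"
      using descent_sum_preimages_le_fert[OF assms, of \<pi>] by linarith
  qed
  finally show ?thesis .
qed

text \<open>The reduction step: it costs \<open>D / T\<close> per entry and leaves a sum of the same
  form with a new descent weight, so it can be iterated.\<close>

lemma descent_sum_sortable_Suc_le:
  fixes y T :: real
  assumes "0 \<le> y" "0 < T" "0 < n"
  defines "D \<equiv> (1 + T) * (1 + y * T)"
  shows "(\<Sum>\<sigma>\<in>sortable (Suc t) n. y ^ des \<sigma>) \<le>
     T * (D / T) ^ n * (\<Sum>\<pi>\<in>sortable t n. (y * T\<^sup>2 / D) ^ des \<pi>)"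
proof -
  have "fert y \<pi> \<le> T * (D / T) ^ n * (y * T\<^sup>2 / D) ^ des \<pi>" if "\<pi> \<in> sortable t n" for \<pi>
    using fert_le[OF assms(1,2), of \<pi>] that length_perms_of[of \<pi> n] assms(3)
    by (auto simp: sortable_def D_def perms_of_def)
  then have "(\<Sum>\<pi>\<in>sortable t n. fert y \<pi>) \<le> (\<Sum>\<pi>\<in>sortable t n. T * (D / T) ^ n * (y * T\<^sup>2 / D) ^ des \<pi>)"
    by (rule sum_mono)
  then show ?thesis using descent_sum_sortable_Suc_le_fert[OF assms(1), of t n]
    by (simp add: sum_distrib_left)
qed

section \<open>A solution of the catalytic equation\<close>

unbundle fps_syntax

text \<open>For positive \<open>n\<close>, the homogeneous Narayana polynomial of degree
  \<open>n - 1\<close> in \<open>a\<close> and \<open>b\<close>; the recursion reads off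
  coefficients from \<open>m = z (1 + a m) (1 + b m)\<close>.\<close>

fun narayana_coeff :: "real \<Rightarrow> real \<Rightarrow> nat \<Rightarrow> real" where
  "narayana_coeff a b 0 = 0"
| "narayana_coeff a b (Suc n) = (if n = 0 then 1 else 0) + (a + b) * narayana_coeff a b n
     + a * b * (\<Sum>i\<le>n. narayana_coeff a b i * narayana_coeff a b (n - i))"

lemma narayana_coeff_nonneg: "0 \<le> a \<Longrightarrow> 0 \<le> b \<Longrightarrow> 0 \<le> narayana_coeff a b n"
proof (induction n rule: less_induct)
  case (less n)
  show ?case
  proof (cases n)
    case (Suc k)
    have "0 \<le> narayana_coeff a b i" if "i \<le> k" for i using less that Suc by simp
    then show ?thesis unfolding Suc narayana_coeff.simps using less.prems
      by (intro add_nonneg_nonneg mult_nonneg_nonneg sum_nonneg) auto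
  qed simp
qed

definition narayana_series :: "real \<Rightarrow> real \<Rightarrow> real fps" where
  "narayana_series a b = Abs_fps (narayana_coeff a b)"

lemma narayana_series_eq:
  "narayana_series a b = fps_X * ((1 + fps_const a * narayana_series a b) * (1 + fps_const b * narayana_series a b))"
proof -
  have "narayana_series a b $ n = (fps_X * (1 + fps_const (a + b) * narayana_series a b + fps_const (a * b) * (narayana_series a b * narayana_series a b))) $ n" for n
  proof (cases n)
    case (Suc k)
    have "(narayana_series a b * narayana_series a b) $ k = (\<Sum>i\<le>k. narayana_coeff a b i * narayana_coeff a b (k - i))"
      by (simp only: fps_mult_nth narayana_series_def fps_nth_Abs_fps atMost_atLeast0)
    then show ?thesis by (simp add: Suc narayana_series_def[THEN arg_cong[where f="\<lambda>f. f $ _"]] del: fps_const_add fps_const_mult)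
  qed (simp add: narayana_series_def)
  then have "narayana_series a b = fps_X * (1 + fps_const (a + b) * narayana_series a b + fps_const (a * b) * (narayana_series a b * narayana_series a b))"
    by (intro fps_ext)
  also have "1 + fps_const (a + b) * narayana_series a b + fps_const (a * b) * (narayana_series a b * narayana_series a b) =
    (1 + fps_const a * narayana_series a b) * (1 + fps_const b * narayana_series a b)"
    unfolding fps_const_add[symmetric] fps_const_mult[symmetric] by (simp only: algebra_simps mult_1_left mult_1_right)
  finally show ?thesis .
qed

text \<open>Expanding one factor by \<open>narayana_series_eq\<close> gives the recurrence of a
  weighted walk whose steps change the exponent by -1, 0 or 1.\<close>

lemma narayana_series_power_nth_Suc:
  "(narayana_series a b ^ Suc k) $ Suc n = (narayana_series a b ^ k) $ n + (a + b) * (narayana_series a b ^ Suc k) $ n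
     + a * b * (narayana_series a b ^ Suc (Suc k)) $ n"
proof -
  have "narayana_series a b ^ Suc k = narayana_series a b * narayana_series a b ^ k" by simp
  also have "\<dots> = (fps_X * ((1 + fps_const a * narayana_series a b) * (1 + fps_const b * narayana_series a b))) * narayana_series a b ^ k"
    by (simp only: narayana_series_eq[symmetric])
  also have "\<dots> = fps_X * (narayana_series a b ^ k + (fps_const a + fps_const b) * narayana_series a b ^ Suc k
     + (fps_const a * fps_const b) * narayana_series a b ^ Suc (Suc k))"
    by (simp add: algebra_simps del: fps_const_add fps_const_mult)
  finally have "(narayana_series a b ^ Suc k) $ Suc n = (fps_X * (narayana_series a b ^ k + (fps_const a + fps_const b) * narayana_series a b ^ Suc k
     + (fps_const a * fps_const b) * narayana_series a b ^ Suc (Suc k))) $ Suc n" by simp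
  then show ?thesis by (simp del: power_Suc)
qed

lemma narayana_series_power_nth_0 [simp]: "(narayana_series a b ^ Suc k) $ 0 = 0"
  by (simp add: narayana_series_def)

lemma narayana_series_power_nonneg:
  assumes "0 \<le> a" "0 \<le> b"
  shows "0 \<le> (narayana_series a b ^ k) $ n"
proof (induction n arbitrary: k)
  case 0
  then show ?case by (cases k) (auto simp del: power_Suc)
next
  case (Suc n)
  then show ?case using assms
    by (cases k) (auto simp: narayana_series_power_nth_Suc simp del: power_Suc)
qed

text \<open>The coefficients of \<open>narayana_series a b ^ k\<close> are ballot-like numbers; divided by \<open>k\<close> and rescaled by
  powers of \<open>w\<close> they decrease in \<open>k\<close>. This makes the solution of the catalytic equation nonnegative.\<close>

lemma narayana_series_power_ratio:
  assumes "0 \<le> a" "0 \<le> b" "0 < w" "w\<^sup>2 \<le> a * b" "w \<le> 2 * (a + b)"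
  defines "R \<equiv> \<lambda>n k. (narayana_series a b ^ Suc k) $ n * w ^ k / real (Suc k)"
  shows "R n (Suc k) \<le> R n k"
proof (induction n arbitrary: k)
  case 0
  then show ?case by (simp add: R_def del: power_Suc)
next
  case (Suc n)
  have R0: "0 \<le> R n k" for n k using narayana_series_power_nonneg[OF assms(1,2)] assms(3)
    by (simp add: R_def del: power_Suc)
  show ?case
  proof (cases "n = 0")
    case True
    have "R (Suc n) (Suc k) = 0" unfolding R_def True narayana_series_power_nth_Suc by (simp add: narayana_series_def)
    then show ?thesis using R0 by simp
  next
    case False
    \<comment> \<open>In the rescaled recurrence the two neighbours get weights \<open>w\<close> and
      \<open>q\<close>; the assumption on \<open>w\<^sup>2\<close> says
      \<open>w \<le> q\<close>.\<close>
    define q where "q = a * b / w"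
    have q: "w \<le> q" using assms(3,4) by (simp add: q_def field_simps power2_eq_square)
    \<comment> \<open>The value at 0 is a placeholder that gets multiplied by 0. This fits the
      zeroth power, whose coefficient at \<open>n\<close> vanishes as \<open>n\<close> is not
      0.\<close>
    define S where "S k = (if k = 0 then 0 else R n (k - 1))" for k
    have S: "S (Suc k) = R n k" for k by (simp add: S_def)
    have rec: "real (Suc k) * R (Suc n) k = w * real k * S k + (a + b) * real (Suc k) * R n k
        + q * real (k + 2) * R n (Suc k)" for k
    proof -
      have R: "real (Suc k) * R n k = w ^ k * (narayana_series a b ^ Suc k) $ n" for n k
        by (simp add: R_def del: power_Suc of_nat_Suc)
      have "w * real k * S k = w ^ k * (narayana_series a b ^ k) $ n"
      proof (cases k)
        case (Suc j)
        then show ?thesis using R[of j n] by (simp add: S mult.assoc del: of_nat_Suc)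
      qed (use False in simp)
      moreover have "q * real (k + 2) * R n (Suc k) = w ^ k * (a * b * (narayana_series a b ^ Suc (Suc k)) $ n)"
      proof -
        have "q * real (k + 2) * R n (Suc k) = q * (w ^ Suc k * (narayana_series a b ^ Suc (Suc k)) $ n)"
          using R[of "Suc k" n] by (simp del: power_Suc)
        also have "\<dots> = q * w * w ^ k * (narayana_series a b ^ Suc (Suc k)) $ n"
          by (simp add: mult_ac)
        also have "q * w = a * b" using assms(3) by (simp add: q_def)
        finally show ?thesis by (simp only: mult_ac)
      qed
      moreover have "(a + b) * real (Suc k) * R n k = w ^ k * ((a + b) * (narayana_series a b ^ Suc k) $ n)"
        unfolding mult.assoc R by (simp only: mult_ac)
      moreover have "real (Suc k) * R (Suc n) k = w ^ k * ((narayana_series a b ^ k) $ n + (a + b) * (narayana_series a b ^ Suc k) $ n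
          + a * b * (narayana_series a b ^ Suc (Suc k)) $ n)"
        unfolding R narayana_series_power_nth_Suc ..
      ultimately show ?thesis by (simp only: distrib_left)
    qed
    have Sk: "R n k \<le> S k \<or> k = 0" using Suc.IH[of "k - 1"] by (cases k) (auto simp: S_def)
    have D: "0 \<le> R n k - R n (Suc k)" "0 \<le> R n (Suc k) - R n (Suc (Suc k))"
      using Suc.IH[of k] Suc.IH[of "Suc k"] by simp_all
    let ?k = "real k"
    have "w * ?k * R n k \<le> w * ?k * S k"
    proof (cases "k = 0")
      case False
      then show ?thesis using Sk assms(3) by (intro mult_left_mono) auto
    qed simp
    then have 1: "(?k + 2) * (w * ?k * R n k) \<le> (?k + 2) * (w * ?k * S k)" by (rule mult_left_mono) simp
    have 2: "(?k + 1) * (q * (?k + 3) * R n (Suc (Suc k))) \<le> (?k + 1) * (q * (?k + 3) * R n (Suc k))"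
      using D q assms(3) by (intro mult_left_mono) auto
    have 3: "0 \<le> (q - w) * R n (Suc k)" using q R0 by simp
    \<comment> \<open>The extreme case is \<open>k = 0\<close>, where this is the assumption
      \<open>w \<le> 2 * (a + b)\<close>.\<close>
    have "w \<le> (a + b) * ((?k + 1) * (?k + 2))"
    proof -
      have "(a + b) * 2 \<le> (a + b) * ((?k + 1) * (?k + 2))"
        using assms(1,2) by (intro mult_left_mono) (auto simp: algebra_simps)
      then show ?thesis using assms(5) by linarith
    qed
    then have 4: "0 \<le> ((a + b) * ((?k + 1) * (?k + 2)) - w) * (R n k - R n (Suc k))"
      using D by simp
    \<comment> \<open>By 1 and 2, \<open>S k\<close> and \<open>R n (k + 2)\<close> may be replaced
      by \<open>R n k\<close> and \<open>R n (k + 1)\<close>. Since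
      \<open>k (k + 2) - (k + 1)^2 = -1\<close> and \<open>(k + 2)^2 - (k + 1) (k + 3) = 1\<close>,
      the terms with \<open>w\<close> and \<open>q\<close> leave
      \<open>q * R n (k + 1) - w * R n k\<close>.\<close>
    have "(?k + 1) * (?k + 2) * (R (Suc n) k - R (Suc n) (Suc k)) =
       (?k + 2) * (real (Suc k) * R (Suc n) k) - (?k + 1) * (real (Suc (Suc k)) * R (Suc n) (Suc k))"
      by (simp add: algebra_simps)
    also have "\<dots> = (?k + 2) * (w * ?k * S k) + (?k + 2) * ((a + b) * (?k + 1) * R n k) + (?k + 2) * (q * (?k + 2) * R n (Suc k))
       - (?k + 1) * (w * (?k + 1) * R n k) - (?k + 1) * ((a + b) * (?k + 2) * R n (Suc k)) - (?k + 1) * (q * (?k + 3) * R n (Suc (Suc k)))"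
      unfolding rec S by (simp add: algebra_simps)
    also have "\<dots> \<ge> ((a + b) * ((?k + 1) * (?k + 2)) - w) * (R n k - R n (Suc k)) + (q - w) * R n (Suc k)"
      using 1 2 by (simp add: algebra_simps)
    finally have "0 \<le> (?k + 1) * (?k + 2) * (R (Suc n) k - R (Suc n) (Suc k))" using 3 4 by linarith
    moreover have "0 < (?k + 1) * (?k + 2)" by simp
    ultimately have "0 \<le> R (Suc n) k - R (Suc n) (Suc k)" by (metis zero_le_mult_iff not_less)
    then show ?thesis by simp
  qed
qed

text \<open>The catalytic equation with the tail series eliminated. In the notation of the locale
  below, \<open>v * (1 - u)^2\<close> is \<open>x * y\<close> and \<open>u * v * (1 - u - v)\<close>
  is \<open>x * y * H1\<close>.\<close>

lemma catalytic_identity: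
  fixes u v m z :: "'a::comm_ring_1"
  assumes m: "m = z * ((1 + u * (1 - v) * m) * (1 + v * (1 - u) * m))"
  defines "h \<equiv> u * (1 - v)^2 * (m - u * v * m^2)"
  shows "(1 - z) * h = z * ((1 - z) * (u * (1 - v)^2 + (u * (1 - v)^2 + v * (1 - u)^2) * h)
     + h * (u * v * (1 - u - v) - v * (1 - u)^2 * z * h))"
proof -
  define x y q where "x = u * (1 - v)^2" and "y = v * (1 - u)^2" and "q = m - u * v * m^2"
  define A B where "A = 1 + u * (1 - v) * m" and "B = 1 + v * (1 - u) * m"
  define A' B' where "A' = 1 - u * v * (1 - v) * m" and "B' = 1 - u * v * (1 - u) * m"
  define c where "c = x + y + u * v * (1 - u - v)"
  have zAB: "z * (A * B) = m" using m by (simp add: A_def B_def)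
  \<comment> \<open>The parametrization makes these expressions factor through the same
    \<open>A\<close> and \<open>B\<close> as the equation for \<open>m\<close>, so that
    \<open>z * (A * B)\<close> collapses to \<open>m\<close>.\<close>
  have A: "1 + x * q = A * A'" and B: "1 + y * q = B * B'"
    by (simp_all add: A_def A'_def B_def B'_def x_def y_def q_def algebra_simps power2_eq_square)
  have C: "1 + (1 + c) * q - m * (A' * B') = A * B * (1 - u * v * m)"
    by (simp add: A_def A'_def B_def B'_def x_def y_def q_def c_def algebra_simps power2_eq_square)
  have "z * ((1 - z) * (1 + (x + y) * q) + q * (u * v * (1 - u - v) - y * z * (x * q))) =
      z * (1 + c * q - z * ((1 + x * q) * (1 + y * q)))"
    by (simp add: c_def algebra_simps)
  also have "\<dots> = z * (1 + c * q - z * (A * B) * (A' * B'))"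
    unfolding A B by (simp add: mult_ac)
  also have "\<dots> = z * (A * B) * (1 - u * v * m) - z * q"
  proof -
    have "z * (1 + c * q - m * (A' * B')) = z * (1 + (1 + c) * q - m * (A' * B')) - z * q"
      by (simp add: algebra_simps)
    moreover have "z * (A * B * (1 - u * v * m)) = z * (A * B) * (1 - u * v * m)"
      by (simp only: mult.assoc)
    ultimately show ?thesis unfolding C zAB by simp
  qed
  also have "\<dots> = (1 - z) * q"
    unfolding zAB by (simp add: q_def algebra_simps power2_eq_square)
  finally have "(1 - z) * (x * q) = x * (z * ((1 - z) * (1 + (x + y) * q) + q * (u * v * (1 - u - v) - y * z * (x * q))))"
    by (simp add: mult_ac)
  then show ?thesis
    unfolding h_def x_def[symmetric] y_def[symmetric] q_def[symmetric]
    by (simp add: algebra_simps)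
qed

section \<open>Explicit solution for fixed weights\<close>

text \<open>Equality in the last assumption means that \<open>x\<close> is the radius of convergence for the given \<open>y\<close>.
  The number \<open>h k\<close> bounds the weighted count of forests with \<open>k\<close> trees, \<open>t j\<close> that of nonempty forests
  with at least \<open>j\<close> trees, and \<open>H1\<close> the total weight.\<close>

locale critical_weights =
  fixes u v :: real
  assumes u: "0 < u" and v: "0 < v" and u1: "u < 1"
    and subcritical: "4 * u * v \<le> (1 - u) * (1 - v)"
begin

definition x where "x = u * (1 - v)\<^sup>2"
definition y where "y = v * (1 - u)\<^sup>2 / (u * (1 - v)\<^sup>2)"
definition H1 where "H1 = u * (1 - u - v) / (1 - u)\<^sup>2"
text \<open>With these parameters the equation for \<open>m\<close> at \<open>z = 1\<close> has the
  rational root \<open>1 / ((1 - u) * (1 - v))\<close>.\<close>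

definition "a = u * (1 - v)"
definition "b = v * (1 - u)"
definition m where "m = narayana_series a b"
definition hs where "hs = fps_const x * (m - fps_const (u * v) * m\<^sup>2)"
definition h where "h n = hs $ n"
definition t where "t j = H1 - (\<Sum>i<j. h i)"

lemma v1: "v < 1"
proof -
  have "0 < 4 * u * v" using u v by simp
  then have "0 < (1 - u) * (1 - v)" using subcritical by linarith
  then show ?thesis using u1 by (simp add: zero_less_mult_iff)
qed

lemma ab: "0 < a" "0 < b" using u v u1 v1 by (simp_all add: a_def b_def)

lemma x_pos: "0 < x" and y_pos: "0 < y" and xy: "x * y = v * (1 - u)\<^sup>2"
  using u v u1 v1 by (auto simp: x_def y_def)

text \<open>This amounts to \<open>u * v * m\<^sup>2 \<le> m\<close> coefficientwise, which is
  \<open>narayana_series_power_ratio\<close> at \<open>k = 0\<close> with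
  \<open>w = 2 * u * v\<close>. The condition \<open>w\<^sup>2 \<le> a * b\<close> is exactly
  subcriticality.\<close>

lemma h_nonneg: "0 \<le> h n"
proof -
  have w: "(2 * u * v)\<^sup>2 \<le> a * b"
  proof -
    have "(2 * u * v)\<^sup>2 = u * v * (4 * u * v)" by (simp add: power2_eq_square)
    also have "\<dots> \<le> u * v * ((1 - u) * (1 - v))" using subcritical u v by (intro mult_left_mono) auto
    also have "\<dots> = a * b" by (simp add: a_def b_def)
    finally show ?thesis .
  qed
  have "(a + b)\<^sup>2 = 4 * (a * b) + (a - b)\<^sup>2"
    by (simp add: algebra_simps power2_eq_square)
  then have "(2 * u * v)\<^sup>2 \<le> (a + b)\<^sup>2"
    using w mult_pos_pos[OF ab] by (smt (verit) zero_le_power2)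
  then have "2 * u * v \<le> a + b"
    by (rule power2_le_imp_le) (use ab in simp)
  then have "2 * u * v \<le> 2 * (a + b)" using ab by simp
  with w have "(m ^ Suc (Suc 0)) $ n * (2 * u * v) ^ Suc 0 / real (Suc (Suc 0)) \<le>
      (m ^ Suc 0) $ n * (2 * u * v) ^ 0 / real (Suc 0)"
    unfolding m_def using ab u v by (intro narayana_series_power_ratio) auto
  then have "u * v * (m\<^sup>2) $ n \<le> m $ n" by (simp add: power2_eq_square mult_ac)
  then show ?thesis using x_pos by (simp add: h_def hs_def)
qed

text \<open>The bound solves \<open>M = (1 + a M) (1 + b M)\<close>, so partial sums stay below it
  by induction.\<close>

lemma sum_narayana_coeff_le: "(\<Sum>n<N. narayana_coeff a b n) \<le> 1 / ((1 - u) * (1 - v))"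
proof -
  define M1 where "M1 = 1 / ((1 - u) * (1 - v))"
  have M1: "0 < M1" "1 + (a + b) * M1 + a * b * (M1 * M1) = M1"
  proof -
    define d where "d = (1 - u) * (1 - v)"
    have d: "0 < d" using u1 v1 by (simp add: d_def)
    moreover have "M1 = 1 / d" by (simp only: M1_def d_def)
    ultimately have dM: "d * M1 = 1" and "0 < M1" by simp_all
    have "a * b * (M1 * M1) = u * v * (d * M1) * M1" by (simp add: a_def b_def d_def mult_ac)
    then have "a * b * (M1 * M1) = u * v * M1" unfolding dM by simp
    moreover have "1 + (a + b) * M1 + u * v * M1 = (d + a + b + u * v) * M1"
      using dM by (simp add: algebra_simps)
    moreover have "d + a + b + u * v = 1" by (simp add: a_def b_def d_def algebra_simps)
    then have "(d + a + b + u * v) * M1 = M1" by simp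
    ultimately show "0 < M1" "1 + (a + b) * M1 + a * b * (M1 * M1) = M1"
      using \<open>0 < M1\<close> by linarith+
  qed
  have mc0: "0 \<le> narayana_coeff a b n" for n using ab by (simp add: narayana_coeff_nonneg)
  have "(\<Sum>n\<le>N. narayana_coeff a b n) \<le> M1"
  proof (induction N)
    case (Suc N)
    have "(\<Sum>n\<le>Suc N. narayana_coeff a b n) = (\<Sum>n\<le>N. narayana_coeff a b (Suc n))"
      by (subst sum.atMost_Suc_shift) simp
    also have "\<dots> = 1 + (a + b) * (\<Sum>n\<le>N. narayana_coeff a b n) + a * b * (\<Sum>n\<le>N. \<Sum>i\<le>n. narayana_coeff a b i * narayana_coeff a b (n - i))"
      by (simp add: sum.distrib sum_distrib_left)
    also have "\<dots> \<le> 1 + (a + b) * M1 + a * b * (M1 * M1)"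
    proof (intro add_mono mult_left_mono order_refl)
      have "(\<Sum>n\<le>N. \<Sum>i\<le>n. narayana_coeff a b i * narayana_coeff a b (n - i)) \<le> (\<Sum>n\<le>N. narayana_coeff a b n) * (\<Sum>n\<le>N. narayana_coeff a b n)"
        using mc0 by (intro sum_triangle_le_mult) auto
      also have "\<dots> \<le> M1 * M1" using Suc M1 mc0 by (intro mult_mono) (auto intro: sum_nonneg)
      finally show "(\<Sum>n\<le>N. \<Sum>i\<le>n. narayana_coeff a b i * narayana_coeff a b (n - i)) \<le> M1 * M1" .
    qed (use ab Suc in auto)
    finally show ?case using M1 by simp
  qed (use M1 in simp)
  moreover have "(\<Sum>n<N. narayana_coeff a b n) \<le> (\<Sum>n\<le>N. narayana_coeff a b n)" using mc0 by (intro sum_mono2) auto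
  ultimately show ?thesis by (simp add: M1_def)
qed

text \<open>The series \<open>h\<close> sums to \<open>x * (p - u * v * p\<^sup>2)\<close>, where
  \<open>p \<le> M1\<close> is the sum of the Narayana coefficients. By subcriticality this
  expression increases in \<open>p\<close> up to \<open>M1\<close>, where it equals
  \<open>H1\<close>.\<close>

lemma t_nonneg: "0 \<le> t j"
proof -
  define M1 where "M1 = 1 / ((1 - u) * (1 - v))"
  have mc0: "0 \<le> narayana_coeff a b n" for n using ab by (simp add: narayana_coeff_nonneg)
  have sm: "summable (narayana_coeff a b)"
    using mc0 sum_narayana_coeff_le by (rule summableI_nonneg_bounded)
  define p where "p = suminf (narayana_coeff a b)"
  have p: "p \<le> M1" unfolding p_def M1_def using sm sum_narayana_coeff_le by (rule suminf_le_const)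
  have "(\<lambda>n. \<Sum>i\<le>n. narayana_coeff a b i * narayana_coeff a b (n - i)) sums (p * p)"
    unfolding p_def using sm mc0 by (intro Cauchy_product_sums) auto
  moreover have "narayana_coeff a b sums p" using sm by (simp add: p_def summable_sums)
  ultimately have "(\<lambda>n. x * (narayana_coeff a b n - u * v * (\<Sum>i\<le>n. narayana_coeff a b i * narayana_coeff a b (n - i)))) sums (x * (p - u * v * (p * p)))"
    by (intro sums_mult sums_diff)
  moreover have "h = (\<lambda>n. x * (narayana_coeff a b n - u * v * (\<Sum>i\<le>n. narayana_coeff a b i * narayana_coeff a b (n - i))))"
    by (rule ext) (simp add: h_def hs_def m_def narayana_series_def power2_eq_square fps_mult_nth[of "Abs_fps _"] atMost_atLeast0)
  ultimately have "h sums (x * (p - u * v * (p * p)))" by simp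
  then have "(\<Sum>i<j. h i) \<le> x * (p - u * v * (p * p))"
    using h_nonneg sum_le_suminf[of h "{..<j}"] by (auto simp: sums_iff)
  also have "\<dots> \<le> x * (M1 - u * v * (M1 * M1))"
  proof -
    have "0 < (1 - u) * (1 - v)" using u1 v1 by simp
    moreover have "4 * (u * v) \<le> (1 - u) * (1 - v)" using subcritical by simp
    ultimately have "4 * (u * v) * M1 \<le> 1"
      unfolding M1_def times_divide_eq_right mult_1_right by (simp only: pos_divide_le_eq mult_1)
    then have "u * v * M1 \<le> 1 / 4" by simp
    moreover have "u * v * p \<le> u * v * M1" using p u v by simp
    ultimately have "0 \<le> (M1 - p) * (1 - u * v * M1 - u * v * p)" using p by (intro mult_nonneg_nonneg) auto
    then have "p - u * v * (p * p) \<le> M1 - u * v * (M1 * M1)" by (simp add: algebra_simps)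
    then show ?thesis using x_pos by simp
  qed
  also have "\<dots> = H1"
  proof -
    have "M1 = (1 - u) * (1 - v) * (M1 * M1)" using u1 v1 by (simp add: M1_def)
    then have "M1 - u * v * (M1 * M1) = M1 * M1 * (1 - u - v)"
      by (simp add: algebra_simps)
    then have "x * (M1 - u * v * (M1 * M1)) = x * (M1 * M1) * (1 - u - v)"
      by simp
    also have "x * (M1 * M1) = u / (1 - u)\<^sup>2"
      using u1 v1 by (simp add: x_def M1_def power2_eq_square)
    finally show ?thesis by (simp add: H1_def)
  qed
  finally show ?thesis by (simp add: t_def)
qed

text \<open>The catalytic equation in coefficients: \<open>catalytic_identity\<close> with the tail
  series put back and \<open>1 - z\<close> cancelled.\<close>

lemma h_Suc:
  "h (Suc k) = x * ((if k = 0 then 1 else 0) + (1 + y) * h k + y * (\<Sum>i\<le>k. h i * t (k - i)))"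
proof -
  define U V where "U = fps_const u" and "V = fps_const v"
  define ts where "ts = Abs_fps t"
  have c: "fps_const x = U * (1 - V)\<^sup>2" "fps_const (x * y) = V * (1 - U)\<^sup>2" "fps_const (u * v) = U * V"
    "fps_const a = U * (1 - V)" "fps_const b = V * (1 - U)"
    unfolding xy by (simp_all add: U_def V_def x_def a_def b_def fps_const_1_eq_1[symmetric] del: fps_const_1_eq_1)
  have cH: "fps_const (x * y) * fps_const H1 = U * V * (1 - U - V)"
    unfolding xy using u1 by (simp add: U_def V_def H1_def fps_const_1_eq_1[symmetric] mult_ac del: fps_const_1_eq_1)
  \<comment> \<open>Telescoping, from \<open>t 0 = H1\<close> and
    \<open>t (Suc n) = t n - h n\<close>.\<close>
  have T: "(1 - fps_X) * ts = fps_const H1 - fps_X * hs"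
  proof (rule fps_ext)
    fix n
    show "((1 - fps_X) * ts) $ n = (fps_const H1 - fps_X * hs) $ n"
      by (cases n) (simp_all add: ts_def t_def h_def algebra_simps)
  qed
  have hs: "hs = U * (1 - V)\<^sup>2 * (m - U * V * m\<^sup>2)" by (simp only: hs_def c)
  have "m = fps_X * ((1 + U * (1 - V) * m) * (1 + V * (1 - U) * m))"
    unfolding m_def c(4,5)[symmetric] by (rule narayana_series_eq)
  note id = catalytic_identity[OF this, folded hs]
  have "(1 - fps_X) * hs = fps_X * ((1 - fps_X) * (fps_const x + (fps_const x + fps_const (x * y)) * hs)
     + hs * (fps_const (x * y) * (fps_const H1 - fps_X * hs)))"
    unfolding right_diff_distrib cH unfolding c using id by (simp only: right_diff_distrib mult.assoc)
  also have "\<dots> = (1 - fps_X) * (fps_X * (fps_const x + (fps_const x + fps_const (x * y)) * hs + fps_const (x * y) * (hs * ts)))"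
    unfolding T[symmetric] by (simp only: algebra_simps)
  finally have "hs = fps_X * (fps_const x + (fps_const x + fps_const (x * y)) * hs + fps_const (x * y) * (hs * ts))"
    by (subst (asm) mult_cancel_left) (auto simp: fps_eq_iff dest: spec[of _ 0])
  then have "hs $ Suc k = (fps_X * (fps_const x + (fps_const x + fps_const (x * y)) * hs + fps_const (x * y) * (hs * ts))) $ Suc k"
    by simp
  then show ?thesis
    by (simp add: h_def ts_def fps_mult_nth[of hs] atMost_atLeast0 algebra_simps sum_distrib_left)
qed

lemma h_0: "h 0 = 0"
  by (simp add: h_def hs_def m_def narayana_series_def power2_eq_square)

end

section \<open>2-stack-sortable permutations and forests\<close>

text \<open>A plane forest encodes a 231-avoiding permutation: \<open>word\<close> lists the nodes in preorder, labelled in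
  postorder from \<open>Suc c\<close> on, so the trees are the sum components.\<close>

datatype tree = Node (children: "tree list")

fun nodes :: "tree list \<Rightarrow> nat" where
  "nodes [] = 0"
| "nodes (Node g # f) = Suc (nodes g + nodes f)"

fun word :: "nat \<Rightarrow> tree list \<Rightarrow> nat list" where
  "word c [] = []"
| "word c (Node g # f) = Suc (c + nodes g) # word c g @ word (Suc (c + nodes g)) f"

lemma nodes_append [simp]: "nodes (f @ f') = nodes f + nodes f'"
  by (induction f rule: nodes.induct) auto

lemma word_append: "word c (f @ f') = word c f @ word (c + nodes f) f'"
  by (induction c f rule: word.induct) (auto simp: add_ac)

lemma length_word [simp]: "length (word c f) = nodes f"
  by (induction c f rule: word.induct) auto

lemma set_word: "set (word c f) = {Suc c..c + nodes f}"
  by (induction c f rule: word.induct) auto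

lemma word_shift: "word (d + c) f = map ((+) d) (word c f)"
  by (induction c f rule: word.induct) (auto simp: add_ac)

lemma nodes_eq_0_iff [simp]: "nodes f = 0 \<longleftrightarrow> f = []"
  by (cases f rule: nodes.cases) auto

lemma length_le_nodes: "length f \<le> nodes f"
  by (induction f rule: nodes.induct) auto

lemma finite_nodes_le: "finite {f. nodes f \<le> N}"
proof (induction N)
  case (Suc N)
  have "{f. nodes f \<le> Suc N} \<subseteq> insert [] ((\<lambda>(g, f). Node g # f) ` ({f. nodes f \<le> N} \<times> {f. nodes f \<le> N}))"
  proof
    fix f assume "f \<in> {f. nodes f \<le> Suc N}"
    then show "f \<in> insert [] ((\<lambda>(g, f). Node g # f) ` ({f. nodes f \<le> N} \<times> {f. nodes f \<le> N}))"
      by (cases f rule: nodes.cases) auto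
  qed
  then show ?case using Suc by (meson finite.insertI finite_SigmaI finite_imageI finite_subset)
qed simp

text \<open>Since the sorted result is increasing, all entries before the maximum are smaller than
  those after it. The former give the earlier trees; the maximum is the root of the last tree, with
  the latter below it.\<close>

lemma stack_sort_eq_upt_imp_word:
  assumes "distinct \<pi>" "stack_sort \<pi> = [Suc c..<Suc (c + n)]"
  shows "\<exists>f. \<pi> = word c f \<and> nodes f = n"
  using assms
proof (induction "length \<pi>" arbitrary: \<pi> c n rule: less_induct)
  case less
  show ?case
  proof (cases "\<pi> = []")
    case True
    have "length (stack_sort \<pi>) = n" using less.prems(2) by (simp del: upt_Suc)
    then have "n = 0" using True by simp
    then show ?thesis using True by (intro exI[of _ "[]"]) simp
  next
    case False
    then obtain L m R where LR: "\<pi> = L @ m # R"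
        "\<And>a. a \<in> set L \<Longrightarrow> a < m" "\<And>a. a \<in> set R \<Longrightarrow> a < m"
      using distinct_max_split less.prems(1) by metis
    have d: "distinct L" "distinct R" using less.prems(1) LR by auto
    define l r where "l = length L" and "r = length R"
    have len: "length (stack_sort L) = l" "length (stack_sort R) = r"
      using stack_sort_distinct_set_length d by (simp_all add: l_def r_def)
    have eq: "stack_sort L @ stack_sort R @ [m] = [Suc c..<Suc (c + n)]"
      using stack_sort_append_max[OF LR(2,3)] less.prems(2) LR(1) by simp
    from arg_cong[OF eq, of length] have n: "n = l + r + 1" using len by simp
    have "[Suc c..<Suc (c + n)] = [Suc c..<Suc (c + l)] @ [Suc (c + l)..<Suc (c + l + r)] @ [Suc (c + l + r)]"
      using upt_add_eq_append[of "Suc c" "Suc (c + l)" "r + 1"] by (simp add: n add_ac)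
    with eq have "stack_sort L = [Suc c..<Suc (c + l)]" "stack_sort R = [Suc (c + l)..<Suc (c + l + r)]"
        "m = Suc (c + l + r)"
      using len by (auto simp del: upt_Suc simp: append_eq_append_conv)
    moreover obtain f where "L = word c f" "nodes f = l"
      using less.hyps[of L c l] calculation d LR(1) by auto
    moreover obtain g where "R = word (c + l) g" "nodes g = r"
      using less.hyps[of R "c + l" r] calculation d LR(1) by auto
    ultimately show ?thesis using LR(1)
      by (intro exI[of _ "f @ [Node g]"]) (auto simp: word_append n)
  qed
qed

text \<open>A node below a root is preceded by that root, whose postorder label is larger. So a
  prefix ends in its maximum only at a root, which the \<open>Suc\<close> counts.\<close>

lemma prefix_max_word:
  assumes "0 < i" "i \<le> nodes f" "\<forall>a\<in>set (take i (word c f)). a \<le> last (take i (word c f))"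
  shows "\<exists>p<length f. i = Suc (nodes (take p f))"
  using assms
proof (induction f arbitrary: i c)
  case (Cons T f)
  obtain g where T: "T = Node g" by (cases T)
  define k where "k = i - Suc (nodes g)"
  let ?c = "Suc (c + nodes g)"
  consider "i = 1" | "1 < i" "i \<le> Suc (nodes g)" | "Suc (nodes g) < i" using Cons.prems by linarith
  then show ?case
  proof cases
    case 1
    then show ?thesis by (intro exI[of _ 0]) auto
  next
    case 2
    then have tk: "take i (word c (T # f)) = ?c # take (i - 1) (word c g)"
      by (cases i) (auto simp: T)
    moreover have "length (take (i - 1) (word c g)) = i - 1" using 2 by simp
    then have ne: "take (i - 1) (word c g) \<noteq> []" using 2 by (metis less_irrefl list.size(3) zero_less_diff)
    moreover have "last (take (i - 1) (word c g)) \<in> set (word c g)"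
      using last_in_set[OF ne] by (rule in_set_takeD)
    ultimately have "last (take i (word c (T # f))) \<in> set (word c g)"
      using ne by (simp only: last.simps if_False)
    then have "last (take i (word c (T # f))) < ?c" by (auto simp: set_word)
    then show ?thesis using Cons.prems(3) tk by auto
  next
    case 3
    then have tk: "take i (word c (T # f)) = (?c # word c g) @ take k (word ?c f)"
      by (cases i) (auto simp: T k_def)
    have k: "0 < k" "k \<le> nodes f" using 3 Cons.prems by (auto simp: k_def T)
    then have "length (take k (word ?c f)) = k" by simp
    then have "take k (word ?c f) \<noteq> []" using k(1) by (metis less_irrefl list.size(3))
    then obtain p where "p < length f" "k = Suc (nodes (take p f))"
      using Cons.IH[of k ?c] Cons.prems(3) k unfolding tk by auto
    then show ?thesis using 3 by (intro exI[of _ "Suc p"]) (auto simp: T k_def)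
  qed
qed simp

section \<open>Preimage weights of forest words\<close>

lemma fert_not_max: "xs \<noteq> [] \<Longrightarrow> \<not> (\<forall>a\<in>set xs. a \<le> last xs) \<Longrightarrow> fert y xs = 0"
  by (subst fert.simps) (auto simp: not_le)

text \<open>The last node in preorder is a proper descendant of the last root, hence not the
  maximum.\<close>

lemma fert_word_last_nontrivial:
  assumes "g \<noteq> []"
  shows "fert y (word c (f @ [Node g])) = 0"
proof (rule fert_not_max)
  let ?w = "word (c + nodes f) g"
  have g: "?w \<noteq> []" using assms by (metis length_0_conv length_word nodes_eq_0_iff)
  have "last (word c (f @ [Node g])) = last ?w" using g by (simp add: word_append)
  also have "last ?w < Suc (c + nodes f + nodes g)" using last_in_set[OF g] by (simp add: set_word)
  finally show "\<not> (\<forall>a\<in>set (word c (f @ [Node g])). a \<le> last (word c (f @ [Node g])))"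
    by (auto simp: word_append not_le)
qed (simp add: word_append)

text \<open>Standardizes a prefix ending at a root: the earlier trees followed by a leaf, where
  \<open>d\<close> is the label gap left by the descendants of that root.\<close>

lemma fert_word_left:
  "fert y (word 0 f @ [Suc (nodes f + d)]) = fert y (word 0 (f @ [Node []]))"
proof -
  define h where "h v = (if v \<le> nodes f then v else v + d)" for v
  have "map h (word 0 f) = word 0 f"
    by (rule map_idI) (simp add: h_def set_word)
  then have "map h (word 0 (f @ [Node []])) = word 0 f @ [Suc (nodes f + d)]"
    by (simp add: word_append h_def)
  moreover have "strict_mono_on A h" for A by (auto simp: strict_mono_on_def h_def)
  ultimately show ?thesis using fert_map by metis
qed

text \<open>Standardizes the suffix after a root: its subtrees and the later trees, with the gap at
  the label of the root closed.\<close>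

lemma fert_word_right:
  "fert y (word c g @ word (Suc (c + nodes g)) f) = fert y (word 0 (g @ f))"
proof -
  define h where "h v = (if v \<le> nodes g then c + v else Suc (c + v))" for v
  have "map h (word 0 g) = map ((+) c) (word 0 g)"
    by (rule map_cong) (auto simp: h_def set_word)
  moreover have "map h (word (nodes g) f) = map ((+) (Suc c)) (word (nodes g) f)"
    by (rule map_cong) (auto simp: h_def set_word)
  ultimately have "map h (word 0 (g @ f)) = word c g @ word (Suc (c + nodes g)) f"
    using word_shift[of c 0 g] word_shift[of "Suc c" "nodes g" f] by (simp add: word_append)
  moreover have "strict_mono_on A h" for A by (auto simp: strict_mono_on_def h_def)
  ultimately show ?thesis using fert_map by metis
qed

text \<open>The new leaf is the maximum, at the end of the word. The two trivial cuts give
  \<open>1 + y\<close>; of the others only those right after the root of some tree \<open>p\<close>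
  can contribute, by \<open>prefix_max_word\<close>.\<close>

lemma fert_word_snoc_leaf_le:
  assumes y: "0 \<le> y" and f: "f \<noteq> []"
  shows "fert y (word 0 (f @ [Node []])) \<le> (1 + y) * fert y (word 0 f) +
    y * (\<Sum>p | p < length f \<and> children (f ! p) @ drop (Suc p) f \<noteq> [].
      fert y (word 0 (take p f @ [Node []])) * fert y (word 0 (children (f ! p) @ drop (Suc p) f)))"
proof -
  define w where "w = word 0 f"
  define n where "n = nodes f"
  have lw: "length w = n" by (simp add: w_def n_def)
  have n: "0 < n" using f by (simp add: n_def flip: neq0_conv)
  have nn: "0 \<le> fert y xs" for xs using fert_nonneg[OF y] .
  define s where "s i = y * fert y (take i w) * fert y (drop i w)" for i
  have s: "0 \<le> s i" for i using nn y by (simp add: s_def)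
  define P where "P = {p. p < length f \<and> children (f ! p) @ drop (Suc p) f \<noteq> []}"
  define i where "i p = Suc (nodes (take p f))" for p
  have "\<forall>a\<in>set w. a \<le> Suc n" by (simp add: w_def n_def set_word)
  then have "fert y (word 0 (f @ [Node []])) = (\<Sum>j\<le>n. (if j < n then y else 1) * fert y (take j w) * fert y (drop j w))"
    by (simp add: word_append fert_snoc w_def n_def)
  also have "{..n} = insert 0 (insert n {1..<n})" using n by auto
  also have "(\<Sum>j\<in>insert 0 (insert n {1..<n}). (if j < n then y else 1) * fert y (take j w) * fert y (drop j w)) =
      y * fert y w + (fert y w + (\<Sum>j\<in>{1..<n}. s j))"
    using n by (simp add: lw s_def)
  also have "(\<Sum>j\<in>{1..<n}. s j) \<le> sum s (i ` P)"
  proof -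
    have "s j = 0" if j: "j \<in> {1..<n}" "j \<notin> i ` P" for j
    proof (rule ccontr)
      assume "s j \<noteq> 0"
      then have "fert y (take j w) \<noteq> 0" by (simp add: s_def)
      moreover have "take j w \<noteq> []" using j n lw by auto
      ultimately have "\<forall>a\<in>set (take j w). a \<le> last (take j w)" using fert_not_max by blast
      then obtain p where p: "p < length f" "j = i p"
        using prefix_max_word[of j f 0] j(1) by (auto simp: w_def n_def i_def)
      have "children (f ! p) @ drop (Suc p) f \<noteq> []"
      proof
        assume emp: "children (f ! p) @ drop (Suc p) f = []"
        have "f = take p f @ f ! p # drop (Suc p) f" using p by (simp add: id_take_nth_drop)
        moreover have "f ! p = Node []" using emp by (cases "f ! p") auto
        ultimately have "f = take p f @ [Node []]" using emp by simp
        from arg_cong[OF this, of nodes] have "n = j" by (simp add: n_def p(2) i_def)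
        then show False using j by simp
      qed
      then show False using p j(2) by (auto simp: P_def)
    qed
    then have "(\<Sum>j\<in>{1..<n}. s j) = (\<Sum>j\<in>{1..<n} \<inter> i ` P. s j)"
      by (intro sum.mono_neutral_right) auto
    also have "\<dots> \<le> sum s (i ` P)" using s by (intro sum_mono2) (auto simp: P_def)
    finally show ?thesis .
  qed
  also have "sum s (i ` P) \<le> sum (s \<circ> i) P"
    using s by (intro sum_image_le) (auto simp: P_def)
  also have "sum (s \<circ> i) P = (\<Sum>p\<in>P. y * (fert y (word 0 (take p f @ [Node []])) * fert y (word 0 (children (f ! p) @ drop (Suc p) f))))"
  proof (intro sum.cong refl)
    fix p assume "p \<in> P"
    then have p: "p < length f" by (simp add: P_def)
    define f1 f2 g where "f1 = take p f" and "f2 = drop (Suc p) f" and "g = children (f ! p)"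
    have "f = f1 @ Node g # f2" using p by (simp add: f1_def f2_def g_def id_take_nth_drop)
    then have "w = (word 0 f1 @ [nodes f1 + Suc (nodes g)]) @ (word (nodes f1) g @ word (Suc (nodes f1 + nodes g)) f2)"
      by (simp add: w_def word_append)
    moreover have "length (word 0 f1 @ [nodes f1 + Suc (nodes g)]) = i p" by (simp add: i_def f1_def)
    ultimately have "take (i p) w = word 0 f1 @ [nodes f1 + Suc (nodes g)]"
        "drop (i p) w = word (nodes f1) g @ word (Suc (nodes f1 + nodes g)) f2"
      by (metis append_eq_conv_conj)+
    then show "(s \<circ> i) p = y * (fert y (word 0 (take p f @ [Node []])) * fert y (word 0 (children (f ! p) @ drop (Suc p) f)))"
      by (simp add: s_def fert_word_left fert_word_right flip: f1_def f2_def g_def)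
  qed
  finally show ?thesis by (simp add: P_def w_def sum_distrib_left algebra_simps)
qed

section \<open>Comparison of forest weights with the explicit solution\<close>

context critical_weights
begin

definition W where "W f = x ^ nodes f * fert y (word 0 f)"
text \<open>The cutoff \<open>N\<close> keeps sums finite and carries the induction; excluding the
  empty forest matches \<open>h 0 = 0\<close>.\<close>

definition B where "B N k = {f. nodes f \<le> N \<and> length f = k \<and> f \<noteq> []}"

lemma W_nonneg: "0 \<le> W f"
  using x_pos y_pos fert_nonneg[of y] by (simp add: W_def)

lemma finite_B: "finite (B N k)"
  using finite_nodes_le by (rule finite_subset[rotated]) (auto simp: B_def)

text \<open>Every tree has a node, so at most \<open>N\<close> trees occur; what \<open>t j\<close>
  contains beyond that is nonnegative by \<open>t_nonneg\<close>.\<close>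

lemma sum_W_length_ge:
  assumes "\<And>k. sum W (B N k) \<le> h k"
  shows "sum W {f. nodes f \<le> N \<and> f \<noteq> [] \<and> j \<le> length f} \<le> t j"
proof -
  have "{f. nodes f \<le> N \<and> f \<noteq> [] \<and> j \<le> length f} = (\<Union>k\<in>{j..N}. B N k)"
    using length_le_nodes order_trans by (force simp: B_def)
  moreover have "sum W (\<Union>k\<in>{j..N}. B N k) = (\<Sum>k=j..N. sum W (B N k))"
    using finite_B by (intro sum.UNION_disjoint) (auto simp: B_def)
  moreover have "(\<Sum>k=j..N. sum W (B N k)) \<le> (\<Sum>k=j..N. h k)" by (intro sum_mono assms)
  moreover have "(\<Sum>k=j..N. h k) \<le> t j"
  proof -
    have "{..<max j (Suc N)} = {..<j} \<union> {j..N}" by auto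
    then have "(\<Sum>k<max j (Suc N). h k) = (\<Sum>k<j. h k) + (\<Sum>k=j..N. h k)"
      by (simp add: sum.union_disjoint ivl_disj_int)
    then show ?thesis using t_nonneg[of "max j (Suc N)"] by (simp add: t_def)
  qed
  ultimately show ?thesis by simp
qed

text \<open>The root of tree \<open>p\<close> turns into the leaf ending the first factor, so both
  factors together have as many nodes as \<open>f\<close>; one \<open>x\<close> remains for the new
  leaf.\<close>

lemma W_snoc_leaf_le:
  assumes "f \<noteq> []"
  shows "W (f @ [Node []]) \<le> x * ((1 + y) * W f +
    y * (\<Sum>p | p < length f \<and> children (f ! p) @ drop (Suc p) f \<noteq> [].
      W (take p f @ [Node []]) * W (children (f ! p) @ drop (Suc p) f)))"
proof -
  have nodes: "nodes (take p f @ [Node []]) + nodes (children (f ! p) @ drop (Suc p) f) = nodes f"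
    if "p < length f" for p
  proof -
    have "f = take p f @ Node (children (f ! p)) # drop (Suc p) f" using that by (simp add: id_take_nth_drop)
    from arg_cong[OF this, of nodes] show ?thesis by (simp del: tree.collapse)
  qed
  let ?P = "{p. p < length f \<and> children (f ! p) @ drop (Suc p) f \<noteq> []}"
  have "(\<Sum>p\<in>?P. W (take p f @ [Node []]) * W (children (f ! p) @ drop (Suc p) f)) =
      x ^ nodes f * (\<Sum>p\<in>?P. fert y (word 0 (take p f @ [Node []])) *
        fert y (word 0 (children (f ! p) @ drop (Suc p) f)))"
    unfolding sum_distrib_left
  proof (intro sum.cong refl)
    fix p assume "p \<in> ?P"
    then have p: "p < length f" by simp
    show "W (take p f @ [Node []]) * W (children (f ! p) @ drop (Suc p) f) = x ^ nodes f *
        (fert y (word 0 (take p f @ [Node []])) * fert y (word 0 (children (f ! p) @ drop (Suc p) f)))"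
      unfolding nodes[OF p, symmetric] power_add W_def by (simp only: mult_ac)
  qed
  moreover have "W (f @ [Node []]) \<le> x ^ Suc (nodes f) * ((1 + y) * fert y (word 0 f) +
      y * (\<Sum>p\<in>?P. fert y (word 0 (take p f @ [Node []])) * fert y (word 0 (children (f ! p) @ drop (Suc p) f))))"
    unfolding W_def using fert_word_snoc_leaf_le[OF less_imp_le[OF y_pos] assms] x_pos
    by (simp del: power_Suc)
  ultimately show ?thesis by (simp add: W_def algebra_simps)
qed

text \<open>Only forests ending in a leaf have nonzero weight. Deleting that leaf lowers the node
  bound, and \<open>W_snoc_leaf_le\<close> reproduces the right-hand side of
  \<open>h_Suc\<close>.\<close>

lemma sum_W_B_le: "sum W (B N k) \<le> h k"
proof (induction N arbitrary: k)
  case 0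
  have "B 0 k = {}" by (auto simp: B_def)
  then show ?case using h_nonneg by simp
next
  case (Suc N)
  show ?case
  proof (cases k)
    case 0
    then have "B (Suc N) k = {}" by (auto simp: B_def)
    then show ?thesis using h_nonneg by simp
  next
    case (Suc j)
    define C where "C = {f. nodes f \<le> N \<and> length f = j}"
    have finC: "finite C" using finite_nodes_le by (rule finite_subset[rotated]) (auto simp: C_def)
    have "sum W (B (Suc N) k) \<le> sum W ((\<lambda>f. f @ [Node []]) ` C)"
    proof -
      have "W f = 0" if f: "f \<in> B (Suc N) k" "f \<notin> (\<lambda>f. f @ [Node []]) ` C" for f
      proof -
        obtain f' T where fT: "f = f' @ [T]" using f(1) by (cases f rule: rev_cases) (auto simp: B_def)
        obtain g where T: "T = Node g" by (cases T)
        have "g \<noteq> []" using f by (auto simp: fT T B_def C_def Suc)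
        then show ?thesis by (simp add: W_def fT T fert_word_last_nontrivial)
      qed
      then have "sum W (B (Suc N) k) = sum W (B (Suc N) k \<inter> (\<lambda>f. f @ [Node []]) ` C)"
        using finite_B by (intro sum.mono_neutral_right) auto
      also have "\<dots> \<le> sum W ((\<lambda>f. f @ [Node []]) ` C)"
        using W_nonneg finC by (intro sum_mono2) auto
      finally show ?thesis .
    qed
    also have "\<dots> = (\<Sum>f\<in>C. W (f @ [Node []]))"
      by (subst sum.reindex) (auto simp: inj_on_def)
    also have "\<dots> \<le> x * ((if j = 0 then 1 else 0) + (1 + y) * h j + y * (\<Sum>i\<le>j. h i * t (j - i)))"
    proof (cases "j = 0")
      case True
      then have "C = {[]}" by (auto simp: C_def)
      then show ?thesis using True h_0 by (simp add: W_def fert_snoc[of _ "[]", simplified])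
    next
      case False
      then have CB: "C = B N j" by (auto simp: C_def B_def)
      define G where "G p f = W (take p f @ [Node []]) * W (children (f ! p) @ drop (Suc p) f)" for p f
      define Q where "Q p f \<longleftrightarrow> children (f ! p) @ drop (Suc p) f \<noteq> []" for p f
      have G: "0 \<le> G p f" for p f using W_nonneg by (simp add: G_def)
      \<comment> \<open>For fixed \<open>p\<close> the two forests determine \<open>f\<close>: the
        last \<open>j - Suc p\<close> trees of the second are those after tree \<open>p\<close>, the
        others are its children. The number of children is free, hence the tail
        \<open>t\<close>.\<close>
      have pairs: "(\<Sum>f | f \<in> C \<and> Q p f. G p f) \<le> h (Suc p) * t (j - Suc p)" if p: "p < j" for p
      proof -
        define \<phi> where "\<phi> f = (take p f @ [Node []], children (f ! p) @ drop (Suc p) f)" for f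
        define D where "D = {f. nodes f \<le> N \<and> f \<noteq> [] \<and> j - Suc p \<le> length f}"
        have finD: "finite D" using finite_nodes_le by (rule finite_subset[rotated]) (auto simp: D_def)
        have dec: "f = take p f @ Node (children (f ! p)) # drop (Suc p) f" if "f \<in> C" for f
          using that p by (simp add: C_def id_take_nth_drop)
        have inj: "inj_on \<phi> C"
        proof (rule inj_onI)
          fix f f' assume ff: "f \<in> C" "f' \<in> C" "\<phi> f = \<phi> f'"
          then have "take p f = take p f'" and e: "children (f ! p) @ drop (Suc p) f = children (f' ! p) @ drop (Suc p) f'"
            by (auto simp: \<phi>_def)
          moreover have "length (drop (Suc p) f) = length (drop (Suc p) f')" using ff by (simp add: C_def)
          then have "children (f ! p) = children (f' ! p)" "drop (Suc p) f = drop (Suc p) f'"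
            using e by auto
          ultimately show "f = f'" using dec[OF ff(1)] dec[OF ff(2)] by simp
        qed
        have sub: "\<phi> ` {f \<in> C. Q p f} \<subseteq> B N (Suc p) \<times> D"
        proof
          fix q assume "q \<in> \<phi> ` {f \<in> C. Q p f}"
          then obtain f where f: "f \<in> C" "Q p f" "q = \<phi> f" by auto
          have "nodes f = nodes (take p f) + Suc (nodes (children (f ! p)) + nodes (drop (Suc p) f))"
            using arg_cong[OF dec[OF f(1)], of nodes] by (simp del: tree.collapse)
          moreover have "nodes f \<le> N" "length f = j" using f by (auto simp: C_def)
          ultimately show "q \<in> B N (Suc p) \<times> D" using f(2,3) p
            by (auto simp: \<phi>_def B_def D_def Q_def)
        qed
        have "(\<Sum>f | f \<in> C \<and> Q p f. G p f) = (\<Sum>f | f \<in> C \<and> Q p f. (case \<phi> f of (\<alpha>, \<beta>) \<Rightarrow> W \<alpha> * W \<beta>))"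
          by (simp add: G_def \<phi>_def)
        also have "\<dots> = (\<Sum>(\<alpha>, \<beta>)\<in>\<phi> ` {f \<in> C. Q p f}. W \<alpha> * W \<beta>)"
          by (subst sum.reindex) (auto intro: inj_on_subset[OF inj])
        also have "\<dots> \<le> (\<Sum>(\<alpha>, \<beta>)\<in>B N (Suc p) \<times> D. W \<alpha> * W \<beta>)"
          using sub finD finite_B W_nonneg by (intro sum_mono2) auto
        also have "\<dots> = sum W (B N (Suc p)) * sum W D"
          by (simp add: sum_product sum.cartesian_product)
        also have "\<dots> \<le> h (Suc p) * t (j - Suc p)"
          using Suc.IH sum_W_length_ge[OF Suc.IH, of "j - Suc p"] h_nonneg W_nonneg
          by (intro mult_mono) (auto simp: D_def intro: sum_nonneg)
        finally show ?thesis .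
      qed
      have "(\<Sum>f\<in>C. W (f @ [Node []])) \<le> (\<Sum>f\<in>C. x * ((1 + y) * W f + y * (\<Sum>p\<in>{p\<in>{..<j}. Q p f}. G p f)))"
      proof (intro sum_mono)
        fix f assume f: "f \<in> C"
        then have "f \<noteq> []" "length f = j" using False by (auto simp: C_def)
        then show "W (f @ [Node []]) \<le> x * ((1 + y) * W f + y * (\<Sum>p\<in>{p\<in>{..<j}. Q p f}. G p f))"
          using W_snoc_leaf_le[of f] by (simp add: G_def Q_def)
      qed
      also have "\<dots> = x * ((1 + y) * sum W C + y * (\<Sum>f\<in>C. \<Sum>p | p \<in> {..<j} \<and> Q p f. G p f))"
        by (simp add: sum_distrib_left sum.distrib distrib_left)
      also have "(\<Sum>f\<in>C. \<Sum>p | p \<in> {..<j} \<and> Q p f. G p f) = (\<Sum>p<j. \<Sum>f | f \<in> C \<and> Q p f. G p f)"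
        using finC by (intro sum.swap_restrict) auto
      also have "x * ((1 + y) * sum W C + y * (\<Sum>p<j. \<Sum>f | f \<in> C \<and> Q p f. G p f)) \<le>
          x * ((1 + y) * h j + y * (\<Sum>p<j. h (Suc p) * t (j - Suc p)))"
        using pairs Suc.IH x_pos y_pos
        by (intro mult_left_mono add_mono sum_mono) (auto simp: CB)
      also have "(\<Sum>p<j. h (Suc p) * t (j - Suc p)) = (\<Sum>i\<le>j. h i * t (j - i))"
        using h_0 by (subst sum.atMost_shift) simp
      finally show ?thesis using False by simp
    qed
    also have "\<dots> = h k" unfolding Suc h_Suc ..
    finally show ?thesis .
  qed
qed

lemma sum_fert_word_le:
  assumes "0 < n"
  shows "(\<Sum>f | nodes f = n. fert y (word 0 f)) \<le> H1 * (1 / x) ^ n"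
proof -
  have "(\<Sum>f | nodes f = n. fert y (word 0 f)) * x ^ n = (\<Sum>f | nodes f = n. W f)"
    by (simp add: W_def sum_distrib_left mult.commute[of _ "x ^ n"])
  also have "\<dots> \<le> sum W {f. nodes f \<le> n \<and> f \<noteq> [] \<and> 0 \<le> length f}"
    using assms W_nonneg by (intro sum_mono2 finite_subset[OF _ finite_nodes_le[of n]]) auto
  also have "\<dots> \<le> H1" using sum_W_length_ge[OF sum_W_B_le, of n 0] by (simp add: t_def)
  finally show ?thesis using x_pos by (simp add: field_simps)
qed

text \<open>The 1-stack-sortable permutations are words of forests, whose total weight is bounded by
  \<open>sum_fert_word_le\<close>.\<close>

lemma descent_sum_sortable_2_le:
  assumes "0 < n"
  shows "(\<Sum>\<sigma>\<in>sortable 2 n. y ^ des \<sigma>) \<le> H1 * (1 / x) ^ n"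
proof -
  have y: "0 \<le> y" using y_pos by simp
  have "(\<Sum>\<sigma>\<in>sortable 2 n. y ^ des \<sigma>) \<le> (\<Sum>\<pi>\<in>sortable 1 n. fert y \<pi>)"
    using descent_sum_sortable_Suc_le_fert[OF y, of 1 n] by (simp add: numeral_2_eq_2)
  also have "\<dots> \<le> (\<Sum>\<pi>\<in>word 0 ` {f. nodes f = n}. fert y \<pi>)"
  proof (intro sum_mono2 finite_imageI fert_nonneg y)
    show "sortable 1 n \<subseteq> word 0 ` {f. nodes f = n}"
      using stack_sort_eq_upt_imp_word[of _ 0 n] by (auto simp: sortable_def perms_of_def simp del: upt_Suc)
    show "finite {f. nodes f = n}" using finite_nodes_le[of n] by (rule finite_subset[rotated]) auto
  qed
  also have "\<dots> \<le> (\<Sum>f | nodes f = n. fert y (word 0 f))"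
    using sum_image_le[of "{f. nodes f = n}" "fert y" "word 0"] fert_nonneg[OF y]
      finite_subset[OF _ finite_nodes_le[of n], of "{f. nodes f = n}"] by (auto simp: comp_def)
  also have "\<dots> \<le> H1 * (1 / x) ^ n" by (rule sum_fert_word_le[OF assms])
  finally show ?thesis .
qed

end

text \<open>The values \<open>T = 11 / 30\<close> and \<open>26 / 19\<close> for the two reduction steps, and the critical pair \<open>u = 3 / 5\<close>,
  \<open>v = 1 / 7\<close>, are close to the numerical optimum, whose growth rate is about \<open>21.9656\<close>.\<close>

lemma W4_le:
  assumes "0 < n"
  shows "real (W4 n) \<le> 11 / 30 * (26 / 19) * (27 / 28) * 21.97225 ^ n"
proof -
  interpret critical_weights "3 / 5" "1 / 7"
    by unfold_locales auto
  have y: "y = 7 / 135" and x: "1 / x = 245 / 108" and H1: "H1 = 27 / 28"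
    by (simp_all add: y_def x_def H1_def power2_eq_square)
  let ?y1 = "121 / 1681 :: real"
  have D1: "(1 + 11 / 30) * (1 + 1 * (11 / 30)) / (11 / 30) = (1681 / 330 :: real)"
    "1 * (11 / 30)\<^sup>2 / ((1 + 11 / 30) * (1 + 1 * (11 / 30))) = ?y1"
    by (simp_all add: power2_eq_square)
  have D2: "(1 + 26 / 19) * (1 + ?y1 * (26 / 19)) / (26 / 19) = (45 * 35085 / (26 * 31939) :: real)"
    "?y1 * (26 / 19)\<^sup>2 / ((1 + 26 / 19) * (1 + ?y1 * (26 / 19))) \<le> y"
    by (simp_all add: power2_eq_square y)
  let ?g1 = "1681 / 330 :: real" and ?g2 = "45 * 35085 / (26 * 31939) :: real"
  let ?y2 = "?y1 * (26 / 19)\<^sup>2 / ((1 + 26 / 19) * (1 + ?y1 * (26 / 19)))"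
  have "real (W4 n) = (\<Sum>\<sigma>\<in>sortable (Suc 3) n. 1 ^ des \<sigma>)"
    using length_perms_of[of _ n]
    by (auto simp: W4_def sortable_def four_stack_sortable_def eval_nat_numeral intro!: arg_cong[of _ _ card])
  also have "\<dots> \<le> 11 / 30 * ?g1 ^ n * (\<Sum>\<sigma>\<in>sortable (Suc 2) n. ?y1 ^ des \<sigma>)"
    using descent_sum_sortable_Suc_le[of 1 "11 / 30" n 3, OF _ _ assms] unfolding D1 by (simp add: eval_nat_numeral)
  also have "\<dots> \<le> 11 / 30 * ?g1 ^ n * (26 / 19 * ?g2 ^ n * (\<Sum>\<sigma>\<in>sortable 2 n. ?y2 ^ des \<sigma>))"
    using descent_sum_sortable_Suc_le[of ?y1 "26 / 19" n 2, OF _ _ assms]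
    unfolding D2(1) by (intro mult_left_mono) simp_all
  \<comment> \<open>The new weight, about 0.05181, lies just below \<open>7 / 135\<close> and is
    raised to it.\<close>
  also have "\<dots> \<le> 11 / 30 * ?g1 ^ n * (26 / 19 * ?g2 ^ n * (\<Sum>\<sigma>\<in>sortable 2 n. y ^ des \<sigma>))"
    using D2(2) by (intro mult_left_mono sum_mono power_mono) simp_all
  also have "\<dots> \<le> 11 / 30 * ?g1 ^ n * (26 / 19 * ?g2 ^ n * (27 / 28 * (245 / 108) ^ n))"
    using descent_sum_sortable_2_le[OF assms] unfolding x H1
    by (intro mult_left_mono) simp_all
  also have "\<dots> = 11 / 30 * (26 / 19) * (27 / 28) * (?g1 * ?g2 * (245 / 108)) ^ n"
    unfolding power_mult_distrib by (simp only: mult_ac)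
  \<comment> \<open>The product of the three growth factors is about 21.9703.\<close>
  also have "\<dots> \<le> 11 / 30 * (26 / 19) * (27 / 28) * 21.97225 ^ n"
    by (intro mult_left_mono power_mono) simp_all
  finally show ?thesis .
qed

theorem theorem4p3:
  fixes L :: real
  assumes "(\<lambda>n. root n (real (W4 n))) \<longlonglongrightarrow> L"
  shows "L \<le> 21.97225"
proof (rule LIMSEQ_le[OF assms])
  \<comment> \<open>The constant factor disappears in the limit, since its \<open>n\<close>-th root
    tends to 1.\<close>
  define K :: real where "K = 11 / 30 * (26 / 19) * (27 / 28)"
  show "(\<lambda>n. root n K * 21.97225) \<longlonglongrightarrow> 21.97225"
    using tendsto_mult_right[OF LIMSEQ_root_const[of K], of "21.97225"] by (simp add: K_def)
  have "root n (real (W4 n)) \<le> root n K * 21.97225" if "1 \<le> n" for n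
  proof -
    have "root n (real (W4 n)) \<le> root n (K * 21.97225 ^ n)"
      using W4_le[of n] that by (simp add: K_def)
    also have "\<dots> = root n K * 21.97225"
      using that by (simp add: real_root_mult real_root_power_cancel)
    finally show ?thesis .
  qed
  then show "\<exists>N. \<forall>n\<ge>N. root n (real (W4 n)) \<le> root n K * 21.97225" by blast
qed

end
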